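(* Let $G$ be a finite cyclic group with $\gcd(|G|,6)=1$, put $n=|G|$, and let $g\in G$ with $\mathrm{ord}(g)=n$. Let $S=(n_1g)\cdot(n_2g)\cdot(n_3g)\cdot(n_4g)$, with $n_1,n_2,n_3,n_4\in[1,n]$, be a minimal zero-sum sequence over $G$ of length $4$. If $S$ is reduced and at least one $n_i$ is coprime to $n$, then $\mathrm{ind}(S)=1$.
   Context: A sequence over $G$ is a finite unordered list of elements of $G$ with repetition allowed, written multiplicatively. It is a zero-sum sequence if the sum of its terms is $0$, and a minimal zero-sum sequence if it is zero-sum and no proper nonempty subsequence is zero-sum. For a sequence $S$ over the cyclic group $G$ of order $n$ and a generator $h$ of $G$, write $S=(m_1h)\cdot\ldots\cdot(m_kh)$ with $m_j\in[1,n]$ and set $\|S\|_h=(m_1+\cdots+m_k)/n$. The index of $S$ is $\mathrm{ind}(S)=\min\{\|S\|_h : h\in G,\ \langle h\rangle=G\}$. A minimal zero-sum sequence $S=(n_1g)\cdot\ldots\cdot(n_kg)$ is called reduced if for every prime $p$ dividing $n$ the sequence $(pn_1g)\cdot\ldots\cdot(pn_kg)$ is not a minimal zero-sum sequence. *)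

theory Defs
  imports "HOL-Algebra.Algebra" "HOL-Library.Multiset" "HOL.Rat"
begin

text \<open>
  A sequence over a group is a finite multiset of group elements.  Groups are written
  multiplicatively as in HOL-Algebra, so the paper's $0$, $x + y$ and $m x$ are
  \<open>\<one>\<close>, \<open>x \<otimes> y\<close> and \<open>x [^] m\<close>.
\<close>

text \<open>
  \<open>fold_mset\<close> would need commutativity of the operation on the whole type; hence equal terms
  are grouped and the powers are combined by \<open>finprod\<close>.
\<close>

definition seq_sum :: "('a, 'b) monoid_scheme \<Rightarrow> 'a multiset \<Rightarrow> 'a" where
  "seq_sum G S = finprod G (\<lambda>x. x [^]\<^bsub>G\<^esub> count S x) (set_mset S)"

definition zero_sum :: "('a, 'b) monoid_scheme \<Rightarrow> 'a multiset \<Rightarrow> bool" where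
  "zero_sum G S \<longleftrightarrow> set_mset S \<subseteq> carrier G \<and> seq_sum G S = \<one>\<^bsub>G\<^esub>"

definition minimal_zero_sum :: "('a, 'b) monoid_scheme \<Rightarrow> 'a multiset \<Rightarrow> bool" where
  "minimal_zero_sum G S \<longleftrightarrow>
     zero_sum G S \<and> (\<forall>T. T \<subset># S \<and> T \<noteq> {#} \<longrightarrow> \<not> zero_sum G T)"

text \<open>Multiplying every $n_i$ by $p$ raises every term of the sequence to the \<open>p\<close>-th power.\<close>

definition reduced_seq :: "('a, 'b) monoid_scheme \<Rightarrow> 'a multiset \<Rightarrow> bool" where
  "reduced_seq G S \<longleftrightarrow>
     minimal_zero_sum G S \<and>
     (\<forall>p::nat. Factorial_Ring.prime p \<and> p dvd order G \<longrightarrow>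
        \<not> minimal_zero_sum G (image_mset (\<lambda>x. x [^]\<^bsub>G\<^esub> p) S))"

definition generators :: "('a, 'b) monoid_scheme \<Rightarrow> 'a set" where
  "generators G = {h \<in> carrier G. generate G {h} = carrier G}"

text \<open>
  The exponents range over $[1, n]$ rather than $[0, n-1]$: the identity has coefficient $n$.
\<close>

definition seq_coeff :: "('a, 'b) monoid_scheme \<Rightarrow> 'a \<Rightarrow> 'a \<Rightarrow> nat" where
  "seq_coeff G h x = (THE m. m \<in> {1..order G} \<and> h [^]\<^bsub>G\<^esub> m = x)"

definition seq_norm :: "('a, 'b) monoid_scheme \<Rightarrow> 'a \<Rightarrow> 'a multiset \<Rightarrow> rat" where
  "seq_norm G h S = of_nat (\<Sum>x\<in>#S. seq_coeff G h x) / of_nat (order G)"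

definition seq_index :: "('a, 'b) monoid_scheme \<Rightarrow> 'a multiset \<Rightarrow> rat" where
  "seq_index G S = Min ((\<lambda>h. seq_norm G h S) ` generators G)"

lemma (in group) seq_coeff_unique:
  assumes fin: "finite (carrier G)" and h: "h \<in> generators G" and x: "x \<in> carrier G"
  shows "\<exists>!m. m \<in> {1..order G} \<and> h [^] m = x"
proof -
  have hG: "h \<in> carrier G" and gen: "generate G {h} = carrier G"
    using h unfolding generators_def by blast+
  have ord: "ord h = order G"
    unfolding generate_pow_card[OF hG] gen order_def ..
  have inj: "inj_on (\<lambda>m. h [^] m) {1..order G}"
    using ord_inj'[OF hG] unfolding ord .
  have img: "(\<lambda>m. h [^] m) ` {1..order G} = carrier G"
  proof (rule card_subset_eq[OF fin])
    show "(\<lambda>m. h [^] m) ` {1..order G} \<subseteq> carrier G"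
      using nat_pow_closed[OF hG] by (rule image_subsetI)
    show "card ((\<lambda>m. h [^] m) ` {1..order G}) = card (carrier G)"
    proof -
      have "card ((\<lambda>m. h [^] m) ` {1..order G}) = card {1..order G}"
        by (rule card_image[OF inj])
      also have "\<dots> = card (carrier G)"
        unfolding order_def by simp
      finally show ?thesis .
    qed
  qed
  from x img obtain m where m: "m \<in> {1..order G}" "h [^] m = x"
    unfolding img[symmetric] by (elim imageE) simp
  show ?thesis
  proof (rule ex1I[of _ m])
    show "m \<in> {1..order G} \<and> h [^] m = x"
      by (rule conjI[OF m])
    fix k assume k: "k \<in> {1..order G} \<and> h [^] k = x"
    show "k = m"
    proof (rule inj_onD[OF inj])
      show "h [^] k = h [^] m"
        unfolding conjunct2[OF k] m(2) ..
    qed (rule conjunct1[OF k], rule m(1))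
  qed
qed

end

theory Submission
  imports Defs "HOL-Number_Theory.Cong"
begin

text \<open>
  Suppose that the index is not 1. Since negation turns residue sum \<open>3n\<close> into \<open>n\<close>, for every unit \<open>m\<close>
  the residues of the four \<open>m * n\<^sub>i\<close> modulo \<open>n\<close> sum to \<open>2n\<close>; equivalently, the sawtooth values of the
  \<open>m * n\<^sub>i / n\<close> sum to 0. Let \<open>n\<^sub>1\<close> be a unit. Being reduced means that for every prime \<open>p\<close> dividing \<open>n\<close>
  some term \<open>n\<^sub>j\<close> (``single'') or some \<open>n\<^sub>1 + n\<^sub>j\<close> (``pair'') has order \<open>p\<close>.

  Averaging the sawtooth identity over the units that agree modulo \<open>n / q\<close> shows that a prime \<open>q\<close> of
  pair type divides none of the \<open>n\<^sub>i\<close>. If \<open>n\<close> is not prime and some prime is single, every other prime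
  divides that term, hence is single as well; averaging again excludes \<open>p\<^sup>2\<close> dividing \<open>n\<close> and two single
  primes other than 5. If all primes are of pair type, take primes \<open>p \<le> q\<close> such that \<open>p * q\<close> divides \<open>n\<close>
  and let \<open>n\<^sub>1 + n\<^sub>2\<close> have order \<open>p\<close>. Moving \<open>m\<close> by multiples of \<open>n / q\<close> then identifies two arcs of residues
  modulo \<open>q\<close> up to multiplication by \<open>n\<^sub>3 / n\<^sub>1\<close>; this forces \<open>n\<^sub>1 + n\<^sub>3\<close> or \<open>n\<^sub>1 + n\<^sub>4\<close> to be divisible by \<open>q\<close>,
  and comparing the end points of the arcs shows that all its unit multiples lie within \<open>n / q\<close> of a
  multiple of \<open>n\<close>, which is impossible. For prime \<open>n\<close> the identity becomes a statement about the jumps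
  of three sequences \<open>t * c div n\<close>.
\<close>

text \<open>
  This is \<open>2 n\<close> times the odd sawtooth function at \<open>x / n\<close>, which keeps everything in the integers.
\<close>

definition saw :: "int \<Rightarrow> int \<Rightarrow> int" where
  "saw n x = (if n dvd x then 0 else 2 * (x mod n) - n)"

section \<open>A scaled sawtooth function\<close>

lemma mod_pos_int:
  fixes n x :: int
  assumes "n > 0" "\<not> n dvd x"
  shows "0 < x mod n"
proof -
  have "x mod n \<noteq> 0" using assms(2) by (simp add: dvd_eq_mod_eq_0)
  then show ?thesis using pos_mod_sign[OF assms(1), of x] by linarith
qed

lemma saw_cong: "[x = y] (mod n) \<Longrightarrow> saw n x = saw n y"
  by (auto simp: saw_def cong_def dvd_eq_mod_eq_0)

lemma saw_uminus: "n > 0 \<Longrightarrow> saw n (- x) = - saw n x"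
  unfolding saw_def by (simp add: zmod_zminus1_eq_if dvd_eq_mod_eq_0[symmetric])

lemma saw_cong_neg:
  assumes "n > 0" "n dvd x + y"
  shows "saw n x + saw n y = 0"
proof -
  have "[x = - y] (mod n)"
    using assms(2) by (simp add: cong_iff_dvd_diff)
  then have "saw n x = saw n (- y)" by (rule saw_cong)
  then show ?thesis using saw_uminus[OF assms(1)] by simp
qed

lemma abs_saw_less: "n > 0 \<Longrightarrow> \<bar>saw n x\<bar> < n"
proof -
  assume n: "n > 0"
  have "x mod n < n" using n by simp
  moreover have "x mod n > 0" if "\<not> n dvd x"
    using that n by (rule mod_pos_int[rotated])
  ultimately show ?thesis using n by (auto simp: saw_def abs_less_iff)
qed

text \<open>Half of a sum of two sawtooth values is an integer representing \<open>x + y\<close>, so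
  a bound valid for all representatives of \<open>x + y\<close> bounds the sum.\<close>

lemma saw_add:
  assumes "\<not> n dvd x" "\<not> n dvd y"
  obtains z where "[z = x + y] (mod n)" "saw n x + saw n y = 2 * z"
proof
  show "[x mod n + y mod n - n = x + y] (mod n)"
    by (simp add: cong_def mod_simps)
  show "saw n x + saw n y = 2 * (x mod n + y mod n - n)"
    using assms by (simp add: saw_def)
qed

lemma abs_saw_mult_le:
  assumes "n > 0" "q dvd n" "q dvd x" "2 * q \<le> n"
  shows "\<bar>saw n x\<bar> \<le> n - 2 * q"
proof (cases "n dvd x")
  case True
  then show ?thesis using assms(4) by (simp add: saw_def)
next
  case False
  define r where "r = x mod n"
  have r: "0 < r" "r < n"
    unfolding r_def using False assms(1) by (simp_all add: mod_pos_int)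
  have "q dvd r" using assms unfolding r_def by (simp add: dvd_mod)
  then have "q \<le> r" "q \<le> n - r"
    using r assms(2) by (auto intro!: zdvd_imp_le dvd_diff)
  then show ?thesis using False by (auto simp: saw_def r_def[symmetric] abs_le_iff)
qed

text \<open>The distribution relation of the sawtooth function. Reducing \<open>x\<close> modulo
  \<open>h\<close> only permutes the summands; then all \<open>y + k * h\<close> lie in
  \<open>[0, n)\<close>, which leaves an arithmetic series.\<close>

lemma sum_saw_arith:
  assumes n: "n = q * h" "h > 0" "q > 0"
  shows "(\<Sum>k\<in>{0..<q}. saw n (x + k * h)) = saw n (q * x)"
proof -
  define y j where "y = x mod h" and "j = x div h"
  have x: "x = y + j * h" by (simp add: y_def j_def)
  have y: "0 \<le> y" "y < h" using n by (auto simp: y_def)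
  have npos: "n > 0" using n by simp
  have gauss: "2 * (\<Sum>k\<in>{0..<q}. k) = q * (q - 1)"
    using n(3)
  proof (induction q rule: int_gr_induct)
    case base
    have "{0..<1} = {0::int}" by auto
    then show ?case by simp
  next
    case (step i)
    have "{0..<i + 1} = insert i {0..<i}" using step(1) by auto
    then show ?case using step by (simp add: algebra_simps)
  qed
  have shift: "(\<Sum>k\<in>{0..<q}. saw n (x + k * h)) = (\<Sum>k\<in>{0..<q}. saw n (y + k * h))"
  proof (rule sum.reindex_bij_witness[of _ "\<lambda>k. (k - j) mod q" "\<lambda>k. (k + j) mod q"])
    fix k assume "k \<in> {0..<q}"
    have "[(k + j) mod q = k + j] (mod q)" by simp
    then have "q * h dvd ((k + j) mod q - (k + j)) * h"
      by (simp add: cong_iff_dvd_diff)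
    then have "[y + ((k + j) mod q) * h = x + k * h] (mod n)"
      by (simp add: cong_iff_dvd_diff x n(1) algebra_simps)
    then show "saw n (y + ((k + j) mod q) * h) = saw n (x + k * h)"
      by (rule saw_cong)
  qed (use n(3) in \<open>auto simp: mod_simps\<close>)
  have qx: "saw n (q * x) = saw n (q * y)"
    by (rule saw_cong) (simp add: cong_iff_dvd_diff x n(1) algebra_simps)
  show ?thesis
  proof (cases "y = 0")
    case True
    \<comment> \<open>At \<open>k = 0\<close> the sawtooth value is 0 and not \<open>- n\<close>, so
      this summand is split off.\<close>
    have "{0..<q} = insert 0 {1..<q}" using n(3) by auto
    then have "(\<Sum>k\<in>{0..<q}. saw n (k * h)) = (\<Sum>k\<in>{1..<q}. saw n (k * h))"
      by (simp add: saw_def)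
    also have "\<dots> = (\<Sum>k\<in>{1..<q}. 2 * (k * h) - n)"
    proof (rule sum.cong[OF refl])
      fix k assume k: "k \<in> {1..<q}"
      then have "0 < k * h" "k * h < n" using n by auto
      then show "saw n (k * h) = 2 * (k * h) - n"
        using zdvd_not_zless by (auto simp: saw_def)
    qed
    also have "\<dots> = h * (2 * (\<Sum>k\<in>{1..<q}. k)) - (q - 1) * n"
      using n(3) by (simp add: sum_subtractf sum_distrib_left sum_distrib_right algebra_simps)
    also have "(\<Sum>k\<in>{1..<q}. k) = (\<Sum>k\<in>{0..<q}. k)"
      using \<open>{0..<q} = insert 0 {1..<q}\<close> by simp
    also have "h * (2 * (\<Sum>k\<in>{0..<q}. k)) - (q - 1) * n = 0"
      unfolding gauss n(1) by simp
    finally show ?thesis unfolding shift qx using True by (simp add: saw_def)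
  next
    case False
    have "(\<Sum>k\<in>{0..<q}. saw n (y + k * h)) = (\<Sum>k\<in>{0..<q}. 2 * (y + k * h) - n)"
    proof (rule sum.cong[OF refl])
      fix k assume k: "k \<in> {0..<q}"
      then have "h * k + h * 1 \<le> h * q" 
        using n(2) by (metis atLeastLessThan_iff distrib_left less_imp_le mult_left_mono zless_imp_add1_zle)
      then have "0 < y + k * h" "y + k * h < n"
        using n y False k by (auto simp: algebra_simps intro!: add_pos_nonneg)
      then show "saw n (y + k * h) = 2 * (y + k * h) - n"
        using zdvd_not_zless by (auto simp: saw_def)
    qed
    also have "\<dots> = 2 * q * y + h * (2 * (\<Sum>k\<in>{0..<q}. k)) - q * n"
      using n(3) by (simp add: sum_subtractf sum.distrib sum_distrib_left sum_distrib_right algebra_simps)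
    also have "\<dots> = 2 * (q * y) - n"
      unfolding gauss n(1) by (simp add: algebra_simps)
    also have "\<dots> = saw n (q * y)"
    proof -
      have "0 < q * y" "q * y < n" using n y False by auto
      then show ?thesis using zdvd_not_zless by (auto simp: saw_def)
    qed
    finally show ?thesis unfolding shift qx .
  qed
qed

section \<open>Multiplying by units\<close>

lemma coprime_int_primesI:
  fixes m n :: int
  assumes "n \<noteq> 0" "\<And>r. Factorial_Ring.prime r \<Longrightarrow> r dvd m \<Longrightarrow> r dvd n \<Longrightarrow> False"
  shows "coprime m n"
proof (rule ccontr)
  assume "\<not> coprime m n"
  then have "\<not> is_unit (gcd m n)" by (simp add: coprime_iff_gcd_eq_1)
  moreover have "gcd m n \<noteq> 0" using assms(1) by simp
  ultimately obtain r where "Factorial_Ring.prime r" "r dvd gcd m n"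
    using prime_divisor_exists by blast
  then show False using assms(2)[of r] by auto
qed

text \<open>A multiple of \<open>e\<close> is added to \<open>c\<close> that contains exactly the
  primes of \<open>n\<close> missing \<open>c\<close>: a prime of \<open>n\<close> that divides
  \<open>c\<close> divides neither \<open>e\<close> nor the product of these primes.\<close>

lemma coprime_lift:
  fixes n e c :: int
  assumes "n \<noteq> 0" "e dvd n" "coprime c e"
  obtains m where "coprime m n" "[m = c] (mod e)"
proof
  define P where "P = {r. Factorial_Ring.prime r \<and> r dvd n \<and> \<not> r dvd c}"
  have fin: "finite P"
    unfolding P_def by (rule finite_subset[OF _ finite_prime_divisors[OF assms(1)]]) auto
  show "[c + e * \<Prod>P = c] (mod e)" by (simp add: cong_def)
  show "coprime (c + e * \<Prod>P) n"
  proof (rule coprime_int_primesI[OF assms(1)])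
    fix r :: int assume r: "Factorial_Ring.prime r" "r dvd c + e * \<Prod>P" "r dvd n"
    show False
    proof (cases "r dvd c")
      case True
      then have "\<not> r dvd e" using assms(3) r(1)
        by (meson coprime_common_divisor not_prime_unit)
      moreover have "\<not> r dvd \<Prod>P"
      proof
        assume "r dvd \<Prod>P"
        then obtain s where "s \<in> P" "r dvd s"
          using fin r(1) by (auto simp: prime_dvd_prod_iff)
        then show False using r(1) True by (metis (mono_tags, lifting) P_def mem_Collect_eq primes_dvd_imp_eq)
      qed
      moreover have "r dvd e * \<Prod>P" using r(2) True by (simp add: dvd_add_right_iff)
      ultimately show False using r(1) prime_dvd_mult_iff by blast
    next
      case False
      then have "r dvd \<Prod>P" using r fin by (auto simp: P_def intro!: dvd_prodI)
      then show False using r(2) False by (metis dvd_add_left_iff dvd_mult)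
    qed
  qed
qed

text \<open>Divided by the gcd, \<open>z\<close> becomes a unit modulo \<open>n div gcd z n\<close>;
  its inverse times \<open>c\<close> lifts to a unit modulo \<open>n\<close>.\<close>

lemma exists_unit_multiple:
  fixes n z c :: int
  assumes "n > 0" "coprime c (n div gcd z n)"
  obtains m where "coprime m n" "[m * z = c * gcd z n] (mod n)"
proof -
  define d where "d = gcd z n"
  define e where "e = n div d"
  have d: "d > 0" using assms(1) by (simp add: d_def)
  have n: "n = e * d" by (simp add: e_def d_def)
  obtain z' where z: "z = z' * d" using d_def by (metis dvd_def gcd_dvd1 mult.commute)
  have "coprime z' e"
  proof -
    have "gcd (z' * d) (e * d) = d" using d_def n z by simp
    then have "gcd z' e * d = 1 * d" using d by (simp add: gcd_mult_right gcd.commute)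
    then have "gcd z' e = 1" using d by (metis less_irrefl mult_cancel_right)
    then show ?thesis by (simp add: coprime_iff_gcd_eq_1)
  qed
  then obtain i where i: "[z' * i = 1] (mod e)" using cong_solve_coprime_int by blast
  then have "coprime i e" using \<open>coprime z' e\<close>
    by (metis coprime_iff_invertible_int mult.commute)
  then have "coprime (c * i) e" using assms(2) by (simp add: e_def d_def)
  obtain m where m: "coprime m n" "[m = c * i] (mod e)"
  proof (rule coprime_lift)
    show "n \<noteq> 0" "e dvd n" using assms(1) n by auto
    show "coprime (c * i) e" by fact
  qed
  have "[m * z' = c * i * z'] (mod e)" using m(2) by (rule cong_mult) simp
  also have "c * i * z' = c * (z' * i)" by simp
  also have "[\<dots> = c * 1] (mod e)" using i by (intro cong_mult) auto
  finally have "e dvd m * z' - c" by (simp add: cong_iff_dvd_diff)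
  then have "e * d dvd (m * z' - c) * d" by (rule mult_dvd_mono) simp
  then have "[m * z = c * d] (mod n)"
    by (simp add: cong_iff_dvd_diff n z algebra_simps)
  then show ?thesis using m(1) that by (simp add: d_def)
qed

lemma odd_ge_5:
  fixes e n :: int
  assumes "e dvd n" "coprime n 6" "e > 1"
  shows "odd e" "e \<ge> 5"
proof -
  have cop: "coprime e 6" using assms(1,2) by (meson coprime_divisors dvd_refl)
  have "\<not> (2 dvd e)"
  proof
    assume "2 dvd e"
    moreover have "(2::int) dvd 6" by simp
    ultimately have "is_unit (2::int)" using cop coprime_common_divisor by blast
    then show False by simp
  qed
  moreover have "e \<noteq> 3" using cop by (auto simp: coprime_iff_gcd_eq_1)
  ultimately show "odd e" "e \<ge> 5" using assms(3) by presburger+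
qed

lemma prime_ge_5_int:
  fixes p n :: int
  assumes "Factorial_Ring.prime p" "p dvd n" "coprime n 6"
  shows "p \<ge> 5"
  using odd_ge_5(2)[OF assms(2,3) prime_gt_1_int[OF assms(1)]] .

text \<open>
  If \<open>e = n / gcd z n\<close>, then some unit multiple of \<open>z\<close> is congruent to \<open>gcd z n * ((e - 1) / 2)\<close>,
  whose distance to the multiples of \<open>n\<close> is \<open>n * (e - 1) / (2 e)\<close>, and \<open>e \<ge> 5\<close>.
\<close>

lemma exists_unit_far:
  fixes n z :: int
  assumes "n > 0" "coprime n 6" "\<not> n dvd z"
  obtains m where "coprime m n" "\<And>w. [w = m * z] (mod n) \<Longrightarrow> 2 * n \<le> 5 * \<bar>w\<bar>"
proof -
  define d where "d = gcd z n"
  define e where "e = n div d"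
  have d: "d > 0" using assms(1) by (simp add: d_def)
  have n: "n = e * d" by (simp add: e_def d_def)
  have "e > 0" using n d assms(1) by (simp add: zero_less_mult_iff)
  moreover have "e \<noteq> 1" using n assms(3) by (metis d_def gcd_dvd1 mult_1)
  ultimately have e: "odd e" "e \<ge> 5" using odd_ge_5[of e n] n assms(2) by auto
  define c where "c = e div 2"
  have ec: "e = 2 * c + 1" using e(1) by (simp add: c_def)
  have "coprime c e" unfolding ec by (rule coprimeI) (metis dvd_add_right_iff dvd_mult)
  then obtain m where m: "coprime m n" "[m * z = c * d] (mod n)"
    using exists_unit_multiple[OF assms(1), of c z] by (auto simp: d_def e_def)
  show ?thesis
  proof (rule that[OF m(1)])
    fix w assume "[w = m * z] (mod n)"
    then have "n dvd w - c * d" using m(2) cong_trans cong_iff_dvd_diff by blast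
    then obtain t where "w - c * d = n * t" by (auto simp: dvd_def)
    then have w: "w = (c + e * t) * d" by (simp add: n algebra_simps)
    have "c \<le> \<bar>c + e * t\<bar>"
    proof (cases "t \<ge> 0")
      case True
      then have "e * t \<ge> 0" using e by simp
      then show ?thesis by simp
    next
      case False
      then have "e * t \<le> e * (-1)" using e by (intro mult_left_mono) auto
      then show ?thesis using ec by simp
    qed
    moreover have "2 * e \<le> 5 * c" using ec e(2) by simp
    ultimately have "2 * e \<le> 5 * \<bar>c + e * t\<bar>" by simp
    then have "2 * e * d \<le> 5 * \<bar>c + e * t\<bar> * d" using d by (intro mult_right_mono) auto
    then show "2 * n \<le> 5 * \<bar>w\<bar>" using d by (simp add: n w abs_mult)
  qed
qed

text \<open>The unit taking \<open>z\<close> to its gcd \<open>d\<close> with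
  \<open>n = e * d\<close> gives the value \<open>(2 - e) * d\<close>, where
  \<open>e \<ge> 5\<close>.\<close>

lemma exists_unit_saw_large:
  fixes n z :: int
  assumes "n > 0" "coprime n 6" "\<not> n dvd z"
  obtains m where "coprime m n" "3 * n \<le> 5 * \<bar>saw n (m * z)\<bar>"
proof -
  define d where "d = gcd z n"
  define e where "e = n div d"
  have d: "d > 0" using assms(1) by (simp add: d_def)
  have n: "n = e * d" by (simp add: e_def d_def)
  have "e > 0" using n d assms(1) by (simp add: zero_less_mult_iff)
  moreover have "e \<noteq> 1" using n assms(3) by (metis d_def gcd_dvd1 mult_1)
  ultimately have e: "odd e" "e \<ge> 5" using odd_ge_5[of e n] n assms(2) by auto
  obtain m where m: "coprime m n" "[m * z = 1 * d] (mod n)"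
    using exists_unit_multiple[OF assms(1), of 1 z] by (auto simp: d_def)
  have "d < n" using n d e by simp
  then have "saw n d = 2 * d - n" using d zdvd_not_zless by (auto simp: saw_def)
  then have "saw n (m * z) = (2 - e) * d" using saw_cong[OF m(2)] by (simp add: n algebra_simps)
  moreover have "3 * e * d \<le> 5 * (e - 2) * d" using e d by (intro mult_right_mono) auto
  ultimately have "3 * n \<le> 5 * \<bar>saw n (m * z)\<bar>" using e d by (simp add: n abs_mult)
  then show ?thesis using m(1) that by blast
qed

text \<open>Half the sum represents \<open>m * (x + y)\<close>, which can be moved
  \<open>2 * n / 5\<close> away from the multiples of \<open>n\<close>. The factor 4 suits the later
  coefficients, which are at least \<open>q - 1\<close> with \<open>q \<ge> 5\<close>.\<close>

lemma exists_unit_saw_pair_large: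
  fixes n x y :: int
  assumes "n > 0" "coprime n 6" "\<not> n dvd x" "\<not> n dvd y" "\<not> n dvd x + y"
  obtains m where "coprime m n" "2 * n \<le> 4 * \<bar>saw n (m * x) + saw n (m * y)\<bar>"
proof -
  obtain m where m: "coprime m n"
    and far: "\<And>w. [w = m * (x + y)] (mod n) \<Longrightarrow> 2 * n \<le> 5 * \<bar>w\<bar>"
    using exists_unit_far assms(1,2,5) by blast
  have "\<not> n dvd m * x" "\<not> n dvd m * y"
    using m assms(3,4) by (simp_all add: coprime_dvd_mult_right_iff coprime_commute)
  then obtain z where z: "[z = m * x + m * y] (mod n)" "saw n (m * x) + saw n (m * y) = 2 * z"
    by (rule saw_add)
  then have "2 * n \<le> 5 * \<bar>z\<bar>" using far[of z] by (simp add: algebra_simps)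
  then have "2 * n \<le> 4 * \<bar>saw n (m * x) + saw n (m * y)\<bar>" unfolding z(2) using assms(1) by simp
  then show ?thesis using m that by blast
qed

text \<open>A prime of \<open>n\<close> other than \<open>q\<close> divides \<open>h\<close>, so the
  shift affects divisibility by \<open>q\<close> alone.\<close>

lemma coprime_shift:
  fixes n m q h k :: int
  assumes "n = q * h" "n > 0" "Factorial_Ring.prime q" "coprime m n" "\<not> q dvd m + k * h"
  shows "coprime (m + k * h) n"
proof (rule coprime_int_primesI)
  fix r :: int assume r: "Factorial_Ring.prime r" "r dvd m + k * h" "r dvd n"
  then consider "r dvd q" | "r dvd h" using assms(1) prime_dvd_mult_iff by blast
  then show False
  proof cases
    case 1
    then have "r = q" using r(1) assms(3) primes_dvd_imp_eq by blast
    then show False using r(2) assms(5) by simp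
  next
    case 2
    then have "r dvd m" using r(2) by (metis dvd_add_left_iff dvd_mult)
    then show False using r(1,3) assms(4) by (meson coprime_common_divisor not_prime_unit)
  qed
qed (use assms(2) in simp)

text \<open>If \<open>q\<close> divides \<open>x\<close>, the shifts change nothing modulo
  \<open>n\<close>; otherwise \<open>k * x\<close> runs through all residues modulo \<open>q\<close>
  and the distribution relation applies.\<close>

lemma sum_saw_shift:
  fixes n m q h x :: int
  assumes n: "n = q * h" "n > 0" and q: "Factorial_Ring.prime q"
  shows "(\<Sum>k\<in>{0..<q}. saw n ((m + k * h) * x)) =
    (if q dvd x then q * saw n (m * x) else saw n (q * (m * x)))"
proof (cases "q dvd x")
  case True
  have "saw n ((m + k * h) * x) = saw n (m * x)" for k
    by (rule saw_cong) (use True n(1) in \<open>auto simp: cong_iff_dvd_diff algebra_simps mult_dvd_mono\<close>)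
  then show ?thesis using True prime_gt_0_int[OF q] by simp
next
  case False
  have q0: "q > 0" using prime_gt_0_int[OF q] .
  have h0: "h > 0" using n q0 by (simp add: zero_less_mult_iff)
  have inj: "inj_on (\<lambda>k. k * x mod q) {0..<q}"
  proof (rule inj_onI)
    fix k l assume kl: "k \<in> {0..<q}" "l \<in> {0..<q}" "k * x mod q = l * x mod q"
    then have "q dvd (k - l) * x" by (simp add: mod_eq_dvd_iff left_diff_distrib)
    then have "q dvd k - l" using False q prime_dvd_mult_iff by blast
    then have "k mod q = l mod q" by (simp add: mod_eq_dvd_iff)
    then show "k = l" using kl by simp
  qed
  have "(\<lambda>k. k * x mod q) ` {0..<q} \<subseteq> {0..<q}" using q0 by auto
  then have bij: "bij_betw (\<lambda>k. k * x mod q) {0..<q} {0..<q}"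
    using inj by (simp add: bij_betw_def endo_inj_surj)
  have "(\<Sum>k\<in>{0..<q}. saw n ((m + k * h) * x)) = (\<Sum>k\<in>{0..<q}. saw n (m * x + (k * x mod q) * h))"
  proof (rule sum.cong[OF refl], rule saw_cong)
    fix k
    have "q dvd k * x - k * x mod q" by (simp add: minus_mod_eq_mult_div)
    then have "q * h dvd (k * x - k * x mod q) * h" by (simp add: mult_dvd_mono)
    then show "[(m + k * h) * x = m * x + (k * x mod q) * h] (mod n)"
      by (simp add: cong_iff_dvd_diff n(1) algebra_simps)
  qed
  also have "\<dots> = (\<Sum>k\<in>{0..<q}. saw n (m * x + k * h))"
    by (rule sum.reindex_bij_betw[OF bij])
  also have "\<dots> = saw n (q * (m * x))"
    using sum_saw_arith[OF n(1) h0 q0] .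
  finally show ?thesis using False by simp
qed

section \<open>Quadruples all of whose unit multiples have residue sum 2n\<close>

text \<open>A failure of the theorem would give such a quadruple, up to the order of its terms. As
  no residue is 0, \<open>saw_sum\<close> says that the residues of a unit multiple sum to
  \<open>2 * n\<close>.\<close>

locale balanced_quad =
  fixes n a b c d :: int
  assumes n_gt_1: "n > 1" and cop6: "coprime n 6"
    and sum0: "n dvd a + b + c + d" and cop_a: "coprime a n"
    and nz: "\<not> n dvd b" "\<not> n dvd c" "\<not> n dvd d"
    and nz2: "\<not> n dvd a + b" "\<not> n dvd a + c" "\<not> n dvd a + d"
    and saw_sum: "coprime m n \<Longrightarrow> saw n (m * a) + saw n (m * b) + saw n (m * c) + saw n (m * d) = 0"
begin

lemma n_pos: "n > 0" using n_gt_1 by simp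

lemma swap_bc: "balanced_quad n a c b d"
  by unfold_locales (use n_gt_1 cop6 sum0 cop_a nz nz2 saw_sum in \<open>simp_all add: algebra_simps\<close>)

lemma swap_cd: "balanced_quad n a b d c"
  by unfold_locales (use n_gt_1 cop6 sum0 cop_a nz nz2 saw_sum in \<open>simp_all add: algebra_simps\<close>)

lemma not_dvd_a: "Factorial_Ring.prime q \<Longrightarrow> q dvd n \<Longrightarrow> \<not> q dvd a"
  using cop_a by (meson coprime_common_divisor not_prime_unit)

lemma nz3: "\<not> n dvd c + d" "\<not> n dvd b + d" "\<not> n dvd b + c"
  using nz2 sum0 
  by (metis add.assoc dvd_add_left_iff, metis add.assoc add.commute add.left_commute dvd_add_left_iff,
      metis add.assoc add.commute add.left_commute dvd_add_left_iff)

text \<open>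
  The sum of \<open>saw n (m' * x)\<close> over the \<open>q\<close> residues \<open>m'\<close> modulo \<open>n\<close> that agree with \<open>m\<close> modulo
  \<open>n div q\<close>. If \<open>q\<^sup>2\<close> divides \<open>n\<close>, all these \<open>m'\<close> are units; otherwise exactly one of them, the
  multiple of \<open>q\<close>, is not.
\<close>

definition avg :: "int \<Rightarrow> int \<Rightarrow> int \<Rightarrow> int" where
  "avg q m x = (if q dvd x then q * saw n (m * x) else saw n (q * (m * x)))"

lemma sum_avg:
  assumes q: "Factorial_Ring.prime q" and n: "n = q * h"
  shows "avg q m a + avg q m b + avg q m c + avg q m d =
    (\<Sum>k\<in>{0..<q}. saw n ((m + k * h) * a) + saw n ((m + k * h) * b)
      + saw n ((m + k * h) * c) + saw n ((m + k * h) * d))"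
  unfolding avg_def sum.distrib sum_saw_shift[OF n n_pos q] ..

lemma average_square:
  assumes q: "Factorial_Ring.prime q" "q * q dvd n" and m: "coprime m n"
  shows "avg q m a + avg q m b + avg q m c + avg q m d = 0"
proof -
  obtain h where n: "n = q * h" and "q dvd h"
    using q(2) by (metis dvd_def dvd_triv_left mult.assoc)
  have "\<not> q dvd m" using m q(1) n by (meson coprime_common_divisor dvd_triv_left not_prime_unit)
  then have "\<not> q dvd m + k * h" for k using \<open>q dvd h\<close> by (simp add: dvd_add_left_iff)
  then show ?thesis
    unfolding sum_avg[OF q(1) n] using saw_sum coprime_shift[OF n n_pos q(1) m] by simp
qed

lemma average:
  assumes q: "Factorial_Ring.prime q" "q dvd n" "\<not> q * q dvd n" and m: "coprime m n"
  obtains m' where "q dvd m'" "[m' = m] (mod n div q)"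
    "avg q m a + avg q m b + avg q m c + avg q m d =
     saw n (m' * a) + saw n (m' * b) + saw n (m' * c) + saw n (m' * d)"
proof -
  define h where "h = n div q"
  define F where "F k = saw n (k * a) + saw n (k * b) + saw n (k * c) + saw n (k * d)" for k
  have n: "n = q * h" using q(2) by (simp add: h_def)
  have q0: "q > 0" using prime_gt_0_int[OF q(1)] .
  have "\<not> q dvd h" using n q(3) by auto
  then have "coprime h q" using q(1) prime_imp_coprime coprime_commute by blast
  then obtain i where i: "[h * i = 1] (mod q)" using cong_solve_coprime_int by blast
  \<comment> \<open>The one shift in the range that makes \<open>m + k0 * h\<close> divisible by
    \<open>q\<close>.\<close>
  define k0 where "k0 = (- m * i) mod q"
  have k0: "k0 \<in> {0..<q}" using q0 by (simp add: k0_def)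
  have "[m + k0 * h = m + (- m * i) * h] (mod q)"
    unfolding k0_def by (intro cong_add cong_mult) auto
  also have "m + (- m * i) * h = m - m * (h * i)" by simp
  also have "[\<dots> = m - m * 1] (mod q)" using i by (intro cong_diff cong_mult) auto
  finally have dvd: "q dvd m + k0 * h" by (simp add: cong_0_iff)
  have "(\<Sum>k\<in>{0..<q} - {k0}. F (m + k * h)) = 0"
  proof (rule sum.neutral, rule ballI)
    fix k assume k: "k \<in> {0..<q} - {k0}"
    have "\<not> q dvd m + k * h"
    proof
      assume "q dvd m + k * h"
      then have "q dvd (m + k * h) - (m + k0 * h)" using dvd by (rule dvd_diff)
      then have "q dvd (k - k0) * h" by (simp add: algebra_simps)
      then have "q dvd k - k0" using \<open>\<not> q dvd h\<close> q(1) prime_dvd_mult_iff by blast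
      then have "k mod q = k0 mod q" by (simp add: mod_eq_dvd_iff)
      then show False using k k0 by simp
    qed
    then show "F (m + k * h) = 0"
      unfolding F_def using saw_sum coprime_shift[OF n n_pos q(1) m] by blast
  qed
  then have "avg q m a + avg q m b + avg q m c + avg q m d = F (m + k0 * h)"
    unfolding sum_avg[OF q(1) n] F_def[symmetric] using k0 by (simp add: sum.remove[of _ k0])
  then show ?thesis using that[of "m + k0 * h"] dvd
    by (simp add: F_def h_def cong_iff_dvd_diff)
qed

text \<open>
  Multiplying by \<open>q\<close> makes the terms cancel in pairs, so that after averaging only the terms divisible
  by \<open>q\<close> survive, with a coefficient too large to balance.
\<close>

lemma pair_not_dvd:
  assumes q: "Factorial_Ring.prime q" "q dvd n" and ab: "n dvd q * (a + b)"
  shows "\<not> q dvd b" "\<not> q dvd c" "\<not> q dvd d"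
proof -
  \<comment> \<open>What is left of \<open>avg\<close> after removing
    \<open>saw n (q * (m * x))\<close>; the removed values cancel in total.\<close>
  define D where "D m x = (if q dvd x then q * saw n (m * x) - saw n (q * (m * x)) else 0)" for m x
  have q5: "q \<ge> 5" using prime_ge_5_int[OF q cop6] .
  have cd: "n dvd q * (c + d)"
    using ab sum0 by (metis (no_types, lifting) add.assoc distrib_left dvd_add_right_iff dvd_mult)
  have D0: "D m b + D m c + D m d = 0" if m: "coprime m n" for m
  proof -
    have zero: "saw n (l * a) + saw n (l * b) + saw n (l * c) + saw n (l * d) = 0" if "q dvd l" for l
    proof -
      obtain j where l: "l = q * j" using \<open>q dvd l\<close> by (rule dvdE)
      have "n dvd l * a + l * b" "n dvd l * c + l * d"
        using dvd_mult[OF ab, of j] dvd_mult[OF cd, of j] by (simp_all add: l algebra_simps)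
      then show ?thesis using saw_cong_neg[OF n_pos] by (simp add: add.assoc)
    qed
    have "avg q m a + avg q m b + avg q m c + avg q m d = 0"
    proof (cases "q * q dvd n")
      case True
      then show ?thesis using average_square[OF q(1) _ m] by simp
    next
      case False
      then show ?thesis using average[OF q _ m] zero by metis
    qed
    moreover have "avg q m x = D m x + saw n (q * m * x)" for x by (simp add: avg_def D_def mult.assoc)
    ultimately show ?thesis using zero[of "q * m"] not_dvd_a[OF q] by (simp add: D_def)
  qed
  \<comment> \<open>With one surviving term, \<open>q\<close> times a value of size at least
    \<open>3 * n / 5\<close> would be below \<open>n\<close>; with two, a quantity of at least
    \<open>2 * n\<close> would be below \<open>2 * n\<close>.\<close>
  have one: "False" if nx: "\<not> n dvd x" "q dvd x" and D: "\<And>m. coprime m n \<Longrightarrow> D m x = 0" for x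
  proof -
    obtain m where m: "coprime m n" "3 * n \<le> 5 * \<bar>saw n (m * x)\<bar>"
      using exists_unit_saw_large[OF n_pos cop6 \<open>\<not> n dvd x\<close>] .
    have "q * saw n (m * x) = saw n (q * (m * x))" using nx(2) D[OF m(1)] by (simp add: D_def)
    then have "q * \<bar>saw n (m * x)\<bar> < n" 
      using abs_saw_less[OF n_pos, of "q * (m * x)"] q5 by (metis abs_mult abs_of_nonneg order_trans zero_le_numeral)
    moreover have "5 * \<bar>saw n (m * x)\<bar> \<le> q * \<bar>saw n (m * x)\<bar>" using q5 by (intro mult_right_mono) auto
    ultimately show False using m(2) n_pos by linarith
  qed
  have two: "False" if nxy: "\<not> n dvd x" "\<not> n dvd y" "\<not> n dvd x + y" "q dvd x" "q dvd y"
    and D: "\<And>m. coprime m n \<Longrightarrow> D m x + D m y = 0" for x y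
  proof -
    obtain m where m: "coprime m n" "2 * n \<le> 4 * \<bar>saw n (m * x) + saw n (m * y)\<bar>"
      using exists_unit_saw_pair_large[OF n_pos cop6 nxy(1-3)] .
    have "q * (saw n (m * x) + saw n (m * y)) = saw n (q * (m * x)) + saw n (q * (m * y))"
      using nxy(4,5) D[OF m(1)] by (simp add: D_def algebra_simps)
    then have "q * \<bar>saw n (m * x) + saw n (m * y)\<bar> = \<bar>saw n (q * (m * x)) + saw n (q * (m * y))\<bar>" 
      using q5 by (metis abs_mult abs_of_nonneg order_trans zero_le_numeral)
    moreover have "\<dots> < 2 * n"
      using abs_saw_less[OF n_pos, of "q * (m * x)"] abs_saw_less[OF n_pos, of "q * (m * y)"] by linarith
    moreover have "4 * \<bar>saw n (m * x) + saw n (m * y)\<bar> \<le> q * \<bar>saw n (m * x) + saw n (m * y)\<bar>"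
      using q5 by (intro mult_right_mono) auto
    ultimately show False using m(2) by linarith
  qed
  have all: "\<not> (q dvd b \<and> q dvd c \<and> q dvd d)"
  proof
    assume "q dvd b \<and> q dvd c \<and> q dvd d"
    moreover have "q dvd a + b + c + d" using sum0 q(2) dvd_trans by blast
    ultimately have "q dvd a" by (simp add: dvd_add_left_iff)
    then show False using not_dvd_a[OF q] by simp
  qed
  have 1: "D m x = 0" if "\<not> q dvd x" for m x using that by (simp add: D_def)
  note nzs = nz nz3
  show "\<not> q dvd b" "\<not> q dvd c" "\<not> q dvd d"
    using all one two D0 1 nzs by (metis add.right_neutral add.left_neutral)+
qed

end

section \<open>Primes that are the order of a single term\<close>

context balanced_quad begin

text \<open>Since \<open>p\<close> divides \<open>b\<close>, averaging gives coefficient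
  \<open>p\<close> to \<open>b\<close> and at most one further term, while each other term
  contributes less than \<open>n\<close>. A unit making the former part large destroys the
  balance.\<close>

lemma not_single_square:
  assumes p: "Factorial_Ring.prime p" "p * p dvd n" and b: "n dvd p * b"
  shows False
proof -
  have pn: "p dvd n" using p(2) dvd_mult_left by blast
  have p5: "p \<ge> 5" using prime_ge_5_int[OF p(1) pn cop6] .
  have "p * p dvd p * b" using p(2) b dvd_trans by blast
  then have pb: "p dvd b" using p5 by simp
  have pa: "\<not> p dvd a" using not_dvd_a[OF p(1) pn] .
  have bound: "\<bar>saw n x\<bar> < n" for x using abs_saw_less[OF n_pos] .
  have two: False if y: "\<not> n dvd b + y" "p dvd y" "\<not> n dvd y" "\<not> p dvd x"
    and sum: "\<And>m. coprime m n \<Longrightarrow> avg p m a + avg p m b + avg p m x + avg p m y = 0" for x y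
  proof -
    obtain m where m: "coprime m n" "2 * n \<le> 4 * \<bar>saw n (m * b) + saw n (m * y)\<bar>"
      using exists_unit_saw_pair_large[OF n_pos cop6 nz(1) y(3) y(1)] .
    have "p * (saw n (m * b) + saw n (m * y)) = - (saw n (p * (m * a)) + saw n (p * (m * x)))"
      using sum[OF m(1)] y(2,4) pb pa by (simp add: avg_def algebra_simps)
    then have "p * \<bar>saw n (m * b) + saw n (m * y)\<bar> = \<bar>saw n (p * (m * a)) + saw n (p * (m * x))\<bar>"
      using p5 by (metis abs_minus_cancel abs_mult abs_of_nonneg order_trans zero_le_numeral)
    moreover have "\<dots> < 2 * n" using bound[of "p * (m * a)"] bound[of "p * (m * x)"] by linarith
    moreover have "4 * \<bar>saw n (m * b) + saw n (m * y)\<bar> \<le> p * \<bar>saw n (m * b) + saw n (m * y)\<bar>"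
      using p5 by (intro mult_right_mono) auto
    ultimately show False using m(2) by linarith
  qed
  have sum: "avg p m a + avg p m b + avg p m c + avg p m d = 0" if "coprime m n" for m
    using average_square[OF p that] .
  consider "p dvd c" "p dvd d" | "\<not> p dvd c" "p dvd d" | "p dvd c" "\<not> p dvd d" | "\<not> p dvd c" "\<not> p dvd d"
    by blast
  then show False
  proof cases
    case 1
    have "p dvd a + b + c + d" using sum0 pn dvd_trans by blast
    then show False using 1 pb pa by (simp add: dvd_add_left_iff)
  next
    case 2
    then show False using two[of d c] sum nz nz3 by blast
  next
    case 3
    then show False using two[of c d] sum nz nz3 by (simp add: algebra_simps)
  next
    case 4
    obtain m where m: "coprime m n" "3 * n \<le> 5 * \<bar>saw n (m * b)\<bar>"
      using exists_unit_saw_large[OF n_pos cop6 nz(1)] .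
    have "p * saw n (m * b) = - (saw n (p * (m * a)) + saw n (p * (m * c)) + saw n (p * (m * d)))"
      using sum[OF m(1)] 4 pb pa by (simp add: avg_def)
    then have "p * \<bar>saw n (m * b)\<bar> = \<bar>saw n (p * (m * a)) + saw n (p * (m * c)) + saw n (p * (m * d))\<bar>"
      using p5 by (metis abs_minus_cancel abs_mult abs_of_nonneg order_trans zero_le_numeral)
    moreover have "\<dots> < 3 * n"
      using bound[of "p * (m * a)"] bound[of "p * (m * c)"] bound[of "p * (m * d)"] by linarith
    moreover have "5 * \<bar>saw n (m * b)\<bar> \<le> p * \<bar>saw n (m * b)\<bar>"
      using p5 by (intro mult_right_mono) auto
    ultimately show False using m(2) by linarith
  qed
qed

text \<open>The prime \<open>q\<close> divides \<open>b\<close> but not \<open>c\<close>. So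
  \<open>b\<close> contributes the same value at \<open>m'\<close> as at \<open>m\<close>, which
  leaves the coefficient \<open>q - 1\<close>, and \<open>c\<close> vanishes after multiplication by
  \<open>q\<close>.\<close>

lemma two_singles_average:
  assumes p: "Factorial_Ring.prime p" and q: "Factorial_Ring.prime q" "q dvd n" "\<not> q * q dvd n" and "p \<noteq> q"
    and b: "n dvd p * b" and c: "n dvd q * c" and m: "coprime m n"
  obtains m' where "q dvd m'" "[m' = m] (mod n div q)" 
    "saw n (q * (m * a)) + (q - 1) * saw n (m * b) + avg q m d = saw n (m' * a) + saw n (m' * d)"
proof -
  obtain h where n: "n = q * h" using q(2) by (rule dvdE)
  have q0: "q > 0" using prime_gt_0_int[OF q(1)] .
  have "q dvd p * b" using b q(2) dvd_trans by blast
  then have qb: "q dvd b" using q(1) p \<open>p \<noteq> q\<close> by (metis prime_dvd_mult_iff primes_dvd_imp_eq)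
  have qc: "\<not> q dvd c"
  proof
    assume "q dvd c"
    moreover have "h dvd c" using c n q0 by simp
    moreover have "coprime q h" using q n by (metis mult_dvd_mono dvd_refl prime_imp_coprime)
    ultimately show False using n nz(2) divides_mult by blast
  qed
  obtain m' where m': "q dvd m'" "[m' = m] (mod n div q)"
    "avg q m a + avg q m b + avg q m c + avg q m d =
     saw n (m' * a) + saw n (m' * b) + saw n (m' * c) + saw n (m' * d)"
    using average[OF q m] .
  have "h dvd m' - m" using m'(2) n q0 by (simp add: cong_iff_dvd_diff)
  then have "n dvd (m' - m) * b" using qb n by (metis mult.commute mult_dvd_mono)
  then have "saw n (m' * b) = saw n (m * b)"
    by (intro saw_cong) (simp add: cong_iff_dvd_diff algebra_simps)
  moreover have "saw n (m' * c) = 0"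
    using m'(1) c by (auto simp: saw_def mult.commute mult.left_commute elim!: dvdE)
  moreover have "saw n (q * (m * c)) = 0"
    using dvd_mult[OF c, of m] by (simp add: saw_def mult.left_commute)
  ultimately have "saw n (q * (m * a)) + (q - 1) * saw n (m * b) + avg q m d = saw n (m' * a) + saw n (m' * d)"
    using m'(3) qb qc not_dvd_a[OF q(1,2)] unfolding avg_def[of _ _ a] avg_def[of _ _ b] avg_def[of _ _ c]
    by (simp add: algebra_simps)
  then show ?thesis using m'(1,2) that by blast
qed

text \<open>Otherwise \<open>d\<close> too has the same value at \<open>m'\<close> and at
  \<open>m\<close>, and \<open>q - 1 \<ge> 4\<close> times the sum for \<open>b\<close> and
  \<open>d\<close> is a difference of two values of size below \<open>n\<close>.\<close>

lemma two_singles_not_dvd: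
  assumes p: "Factorial_Ring.prime p" and q: "Factorial_Ring.prime q" "q dvd n" "\<not> q * q dvd n" and "p \<noteq> q"
    and b: "n dvd p * b" and c: "n dvd q * c"
  shows "\<not> q dvd d"
proof
  assume qd: "q dvd d"
  have q5: "q \<ge> 5" using prime_ge_5_int[OF q(1,2) cop6] .
  obtain h where n: "n = q * h" using q(2) by (rule dvdE)
  obtain m where m: "coprime m n" "2 * n \<le> 4 * \<bar>saw n (m * b) + saw n (m * d)\<bar>"
    using exists_unit_saw_pair_large[OF n_pos cop6 nz(1) nz(3) nz3(2)] .
  obtain m' where m': "[m' = m] (mod n div q)" 
    "saw n (q * (m * a)) + (q - 1) * saw n (m * b) + avg q m d = saw n (m' * a) + saw n (m' * d)"
    using two_singles_average[OF assms m(1)] .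
  have "h dvd m' - m" using m'(1) n q5 by (simp add: cong_iff_dvd_diff)
  then have "n dvd (m' - m) * d" using qd n by (metis mult.commute mult_dvd_mono)
  then have "saw n (m' * d) = saw n (m * d)"
    by (intro saw_cong) (simp add: cong_iff_dvd_diff algebra_simps)
  then have "(q - 1) * (saw n (m * b) + saw n (m * d)) = saw n (m' * a) - saw n (q * (m * a))"
    using m'(2) qd by (simp add: avg_def algebra_simps)
  then have "(q - 1) * \<bar>saw n (m * b) + saw n (m * d)\<bar> = \<bar>saw n (m' * a) - saw n (q * (m * a))\<bar>"
    using q5 by (metis abs_mult abs_of_nonneg diff_ge_0_iff_ge order_trans one_le_numeral)
  moreover have "\<dots> < 2 * n"
    using abs_saw_less[OF n_pos, of "m' * a"] abs_saw_less[OF n_pos, of "q * (m * a)"] by linarith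
  moreover have "4 * \<bar>saw n (m * b) + saw n (m * d)\<bar> \<le> (q - 1) * \<bar>saw n (m * b) + saw n (m * d)\<bar>"
    using q5 by (intro mult_right_mono) auto
  ultimately show False using m(2) by linarith
qed

text \<open>A unit takes \<open>b\<close> to \<open>q\<close>, whose sawtooth value
  \<open>2 * q - n\<close> has the largest size among multiples of \<open>q\<close>. The four other
  arguments are multiples of \<open>q\<close> too, so four values have to balance
  \<open>q - 1\<close> extremal ones.\<close>

lemma two_singles_le_5:
  assumes p: "Factorial_Ring.prime p" and q: "Factorial_Ring.prime q" and "p \<noteq> q" and n: "n = p * q"
    and b: "n dvd p * b" and c: "n dvd q * c"
  shows "q \<le> 5"
proof -
  have p5: "p \<ge> 5" using prime_ge_5_int[OF p _ cop6] n by simp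
  have q0: "q > 0" using prime_gt_0_int[OF q] .
  have qn: "q dvd n" using n by simp
  have qq: "\<not> q * q dvd n"
    using n q0 p q \<open>p \<noteq> q\<close> primes_dvd_imp_eq by auto
  have qd: "\<not> q dvd d" using two_singles_not_dvd[OF p q qn qq \<open>p \<noteq> q\<close> b c] .
  define g where "g = gcd b n"
  have "q dvd b" using b p5 n by simp
  then have "q dvd g" using qn by (simp add: g_def)
  then obtain g' where g': "g = q * g'" by (rule dvdE)
  have "g dvd n" by (simp add: g_def)
  then have "g' dvd p" using n g' q0 by (simp add: mult.commute)
  moreover have "g \<noteq> n" using nz(1) by (metis g_def gcd_dvd1)
  moreover have "g' \<ge> 0" using g' q0 by (metis g_def gcd_ge_0_int zero_le_mult_iff not_less)
  ultimately have g: "g = q" using p g' n 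
    by (metis abs_of_nonneg mult.commute mult.right_neutral prime_int_iff)
  obtain m where m: "coprime m n" "[m * b = 1 * g] (mod n)"
    using exists_unit_multiple[OF n_pos, of 1 b] by (auto simp: g_def)
  obtain m' where m': "q dvd m'"
    "saw n (q * (m * a)) + (q - 1) * saw n (m * b) + avg q m d = saw n (m' * a) + saw n (m' * d)"
    using two_singles_average[OF p q qn qq \<open>p \<noteq> q\<close> b c m(1)] .
  have n2: "2 * q \<le> n" unfolding n using p5 q0 by (intro mult_right_mono) auto
  have "5 * q \<le> n" unfolding n using p5 q0 by (intro mult_right_mono) auto
  have "saw n (m * b) = saw n q" using saw_cong[OF m(2)] g by simp
  also have "\<dots> = 2 * q - n" 
    using n2 q0 zdvd_not_zless[of q n] by (auto simp: saw_def)
  finally have sb: "saw n (m * b) = 2 * q - n" .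
  have "(q - 1) * (n - 2 * q) = saw n (q * (m * a)) + saw n (q * (m * d)) - saw n (m' * a) - saw n (m' * d)"
    using m'(2)[unfolded sb] qd by (simp add: avg_def algebra_simps)
  moreover have bound: "\<bar>saw n x\<bar> \<le> n - 2 * q" if "q dvd x" for x
    using abs_saw_mult_le[OF n_pos qn that n2] .
  ultimately have "(q - 1) * (n - 2 * q) \<le> 4 * (n - 2 * q)"
    using bound[OF dvd_triv_left, of "m * a"] bound[OF dvd_triv_left, of "m * d"]
      bound[OF dvd_mult2[OF m'(1)], of a] bound[OF dvd_mult2[OF m'(1)], of d] by (smt (verit))
  moreover have "0 < n - 2 * q" using \<open>5 * q \<le> n\<close> q0 by simp
  ultimately have "q - 1 \<le> 4" by (rule mult_right_le_imp_le)
  then show ?thesis by simp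
qed

end

section \<open>Multipliers that map arcs to arcs\<close>

text \<open>
  Along the progression with difference 1 one leaves the first arc exactly once per period, whereas
  steps of length \<open>g\<close> leave the second arc at least twice unless \<open>g\<close> is \<open>1\<close> or \<open>-1\<close> modulo \<open>q\<close>.
\<close>

lemma arc_multiplier:
  fixes q T T' g s :: int
  assumes q: "Factorial_Ring.prime q" and g: "\<not> q dvd g" and T': "2 \<le> T'" "T' \<le> q - 2"
    and arcs: "\<And>i. i mod q < T \<longleftrightarrow> (g * i + s) mod q < T'"
  shows "q dvd g - 1 \<or> q dvd g + 1"
proof (rule ccontr)
  assume neg: "\<not> ?thesis"
  have q0: "q > 0" using prime_gt_0_int[OF q] .
  have "coprime g q" using g q prime_imp_coprime coprime_commute by blast
  then obtain g' where g': "[g * g' = 1] (mod q)" using cong_solve_coprime_int by blast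
  \<comment> \<open>If the step from \<open>j\<close> leaves the second arc, the step from the
    corresponding index leaves the first arc, which happens only at its last element.\<close>
  have exit: "((j - s) * g') mod q = T - 1" if j: "j mod q < T'" "\<not> (j + g) mod q < T'" for j
  proof -
    define i where "i = (j - s) * g'"
    have "[g * i + s = (j - s) * 1 + s] (mod q)"
      unfolding i_def using cong_mult[OF cong_refl g', of "j - s"] 
      by (intro cong_add) (simp_all add: mult.left_commute)
    then have gi: "[g * i + s = j] (mod q)" by simp
    then have "[g * (i + 1) + s = j + g] (mod q)"
      using cong_add[OF gi cong_refl, of g] by (simp add: algebra_simps)
    then have i: "i mod q < T" "\<not> (i + 1) mod q < T"
      using arcs[of i] arcs[of "i + 1"] gi j by (simp_all add: cong_def)
    have "i mod q < q" "0 \<le> i mod q" using q0 by auto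
    have "(i + 1) mod q = (if i mod q = q - 1 then 0 else i mod q + 1)"
    proof -
      have "(i + 1) mod q = (i mod q + 1) mod q" by (simp add: mod_simps)
      then show ?thesis using \<open>i mod q < q\<close> \<open>0 \<le> i mod q\<close> by auto
    qed
    then show ?thesis unfolding i_def[symmetric] using i \<open>0 \<le> i mod q\<close> by (auto split: if_splits)
  qed
  \<comment> \<open>Two neighbouring exits would share one index modulo \<open>q\<close>, although
    their indices differ by the unit \<open>g'\<close>.\<close>
  have unique: False if "0 \<le> j" "j + 1 < T'" "T' \<le> (j + g) mod q" "T' \<le> (j + 1 + g) mod q" for j
  proof -
    have "j mod q = j" "(j + 1) mod q = j + 1" using that T' by auto
    then have "((j - s) * g') mod q = ((j + 1 - s) * g') mod q"
      using exit[of j] exit[of "j + 1"] that by simp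
    then have "q dvd g'" by (simp add: mod_eq_dvd_iff algebra_simps)
    then have "q dvd 1" using g' by (meson cong_dvd_iff dvd_mult)
    then show False using q not_prime_unit by blast
  qed
  define r where "r = g mod q"
  have gr: "(j + g) mod q = (j + r) mod q" for j by (simp add: r_def mod_simps)
  have "0 \<le> r" "r < q" using q0 by (auto simp: r_def)
  moreover have "r \<noteq> 0" using g by (auto simp: r_def dvd_eq_mod_eq_0)
  moreover have "r \<noteq> 1"
  proof
    assume "r = 1"
    then have "g mod q = 1 mod q" using T' by (simp add: r_def)
    then show False using neg by (simp add: mod_eq_dvd_iff)
  qed
  moreover have "r \<noteq> q - 1"
  proof
    assume "r = q - 1"
    then have "(g + 1) mod q = 0" using gr[of 1] by (simp add: add.commute)
    then show False using neg by (simp add: dvd_eq_mod_eq_0)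
  qed
  ultimately have r: "2 \<le> r" "r \<le> q - 2" by auto
  \<comment> \<open>In each case the step \<open>r\<close> takes two neighbouring points out of the
    arc without wrapping around: the first two, the last two, or those from \<open>T' - r\<close>
    on.\<close>
  consider "r > T'" | "r \<le> T'" "T' + r \<le> q" | "r \<le> T'" "T' + r > q" by linarith
  then show False
  proof cases
    case 1
    then show False using unique[of 0] gr[of 0] gr[of 1] r T' by simp
  next
    case 2
    then show False using unique[of "T' - 2"] gr[of "T' - 2"] gr[of "T' - 2 + 1"] r T' by simp
  next
    case 3
    then show False using unique[of "T' - r"] gr[of "T' - r"] gr[of "T' - r + 1"] r T' by simp
  qed
qed

text \<open>The bounds on \<open>w\<close> keep \<open>i = 1\<close> below the threshold and
  \<open>i = q - 2\<close> above it, so the arc has the length that \<open>arc_multiplier\<close>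
  requires.\<close>

lemma threshold_index:
  fixes h w r q :: int
  assumes "h > 0" "0 \<le> r" "r < h" "2 * h \<le> w" "w \<le> (q - 2) * h"
  obtains T where "2 \<le> T" "T \<le> q - 2" "\<And>i. h * i + r < w \<longleftrightarrow> i < T"
proof -
  define T where "T = (w - r - 1) div h + 1"
  have eq: "h * i + r < w \<longleftrightarrow> i < T" for i
  proof
    assume "h * i + r < w"
    then have "(h * i) div h \<le> (w - r - 1) div h" using assms(1) by (intro zdiv_mono1) auto
    then show "i < T" using assms(1) by (simp add: T_def)
  next
    assume "i < T"
    then have "h * i \<le> h * ((w - r - 1) div h)" using assms(1) by (simp add: T_def)
    also have "\<dots> \<le> w - r - 1" using assms(1) by (metis add.commute le_add_same_cancel2 mult_div_mod_eq pos_mod_sign)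
    finally show "h * i + r < w" by simp
  qed
  have "h * 1 + r < w" using assms by simp
  moreover have "\<not> h * (q - 2) + r < w" using assms by (simp add: mult.commute)
  ultimately show ?thesis using that[of T] eq by (metis add1_zle_eq not_less one_add_one)
qed

lemma mod_mult_offset:
  fixes h q u r :: int
  assumes "h > 0" "q > 0" "0 \<le> r" "r < h"
  shows "(h * u + r) mod (q * h) = h * (u mod q) + r"
proof -
  have "h * (u mod q) + h \<le> q * h"
  proof -
    have "u mod q + 1 \<le> q" using pos_mod_bound[OF assms(2), of u] by linarith
    then have "h * (u mod q + 1) \<le> h * q" using assms(1) by (intro mult_left_mono) auto
    then show ?thesis by (simp add: algebra_simps)
  qed
  then have "(h * (u mod q) + r) mod (q * h) = h * (u mod q) + r"
    using assms by (intro mod_pos_pos_trivial) auto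
  moreover have "[h * u + r = h * (u mod q) + r] (mod (q * h))"
    by (simp add: cong_iff_dvd_diff right_diff_distrib[symmetric] minus_mod_eq_mult_div)
  ultimately show ?thesis by (simp add: cong_def)
qed

text \<open>With residue sum \<open>2 * n\<close>, both comparisons express that the residues of
  \<open>x\<close> and \<open>y\<close> add up without a carry.\<close>

lemma saw_threshold:
  fixes n x y z u :: int
  assumes n: "n > 0" and nz: "\<not> n dvd x" "\<not> n dvd y" "\<not> n dvd z" "\<not> n dvd u"
    and "n dvd x + y + z + u" and saw: "saw n x + saw n y + saw n z + saw n u = 0"
  shows "x mod n < (x + y) mod n \<longleftrightarrow> (- z) mod n < (x + y) mod n"
proof -
  define x' y' z' u' where "x' = x mod n" and "y' = y mod n" and "z' = z mod n" and "u' = u mod n"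
  have pos: "0 < x'" "0 < y'" "0 < z'" "0 < u'" "x' < n" "y' < n" "z' < n" "u' < n"
    using nz n by (simp_all add: x'_def y'_def z'_def u'_def mod_pos_int)
  have sum: "x' + y' + z' + u' = 2 * n" using saw nz by (simp add: saw_def x'_def y'_def z'_def u'_def)
  have mz: "(- z) mod n = n - z'" using nz by (simp add: zmod_zminus1_eq_if z'_def dvd_eq_mod_eq_0)
  have "(x + y) mod n = (x' + y') mod n" by (simp add: x'_def y'_def mod_simps)
  also have "\<dots> = (if x' + y' < n then x' + y' else x' + y' - n)"
  proof (cases "x' + y' < n")
    case False
    have "(x' + y') mod n = (x' + y' - n) mod n" by simp
    also have "\<dots> = x' + y' - n" using False pos by (intro mod_pos_pos_trivial) auto
    finally show ?thesis using False by simp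
  qed (use pos in simp)
  finally show ?thesis unfolding mz x'_def[symmetric] using pos sum by auto
qed

text \<open>The sawtooth identity is required at all shifts \<open>m + k * h\<close>, units or not,
  so that \<open>k\<close> can run through a full period modulo \<open>q\<close>.\<close>

locale arc_quad = balanced_quad +
  fixes p q h :: int
  assumes p: "Factorial_Ring.prime p" and q: "Factorial_Ring.prime q" and pn: "p dvd n" 
    and n_eq: "n = q * h" and p_le_q: "p \<le> q"
    and order_ab: "n dvd p * (a + b)" and q_ab: "q dvd a + b"
    and nq: "\<not> q dvd c" "\<not> q dvd d"
    and nz_shift: "coprime m n \<Longrightarrow> \<not> n dvd (m + k * h) * a" "coprime m n \<Longrightarrow> \<not> n dvd (m + k * h) * b"
      "coprime m n \<Longrightarrow> \<not> n dvd (m + k * h) * c" "coprime m n \<Longrightarrow> \<not> n dvd (m + k * h) * d"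
    and saw_shift: "coprime m n \<Longrightarrow> saw n ((m + k * h) * a) + saw n ((m + k * h) * b)
      + saw n ((m + k * h) * c) + saw n ((m + k * h) * d) = 0"
begin

lemma arc_swap: "arc_quad n a b d c p q h"
proof -
  interpret s: balanced_quad n a b d c by (rule swap_cd)
  show ?thesis
    by unfold_locales
      (use p q pn n_eq p_le_q order_ab q_ab nq nz_shift saw_shift in \<open>simp_all add: algebra_simps\<close>)
qed

lemma q_ge_5: "q \<ge> 5" using prime_ge_5_int[OF q _ cop6] n_eq by simp

lemma h_pos: "h > 0" using n_eq n_pos q_ge_5 by (simp add: zero_less_mult_iff)

text \<open>The multiplier moves by \<open>j * i * h\<close>. This fixes \<open>m * (a + b)\<close>
  modulo \<open>n\<close>, because \<open>q\<close> divides \<open>a + b\<close>, and moves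
  \<open>m * a\<close> by \<open>j * h\<close>, because \<open>i\<close> inverts
  \<open>a\<close>.\<close>

lemma threshold:
  assumes m: "coprime m n" and i: "[a * i = 1] (mod q)"
  shows "(m * a + j * h) mod n < (m * (a + b)) mod n \<longleftrightarrow>
    (- (m * c) - j * i * c * h) mod n < (m * (a + b)) mod n"
proof -
  define m' where "m' = m + j * i * h"
  have "n dvd m' * (a + b + c + d)" using sum0 by simp
  then have "(m' * a) mod n < (m' * a + m' * b) mod n \<longleftrightarrow> (- (m' * c)) mod n < (m' * a + m' * b) mod n"
    unfolding m'_def using nz_shift[OF m, of "j * i"] saw_shift[OF m, of "j * i"] n_pos
    by (intro saw_threshold[of _ _ _ _ "m' * d"]) (simp_all add: m'_def algebra_simps)
  moreover have "(m' * a + m' * b) mod n = (m * (a + b)) mod n"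
  proof -
    have "q * h dvd (a + b) * h" using q_ab by (simp add: mult_dvd_mono)
    then have "n dvd j * i * ((a + b) * h)" by (simp add: n_eq)
    then show ?thesis by (simp add: mod_eq_dvd_iff m'_def algebra_simps)
  qed
  moreover have "(m' * a) mod n = (m * a + j * h) mod n"
  proof -
    have "q dvd a * i - 1" using i by (simp add: cong_iff_dvd_diff)
    then have "q * h dvd (a * i - 1) * h" by (simp add: mult_dvd_mono)
    then have "n dvd j * ((a * i - 1) * h)" by (simp add: n_eq)
    then show ?thesis by (simp add: mod_eq_dvd_iff m'_def algebra_simps)
  qed
  moreover have "- (m' * c) = - (m * c) - j * i * c * h" by (simp add: m'_def algebra_simps)
  ultimately show ?thesis by simp
qed

lemma inverse_a: obtains i where "[a * i = 1] (mod q)"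
proof -
  have "coprime a q" using cop_a n_eq by simp
  then show ?thesis using that cong_solve_coprime_int by blast
qed

text \<open>Otherwise \<open>m * a\<close> and \<open>- (m * c)\<close> move in parallel by steps of
  \<open>h\<close> and are below \<open>w\<close> at the same time. So they pass 0 at the same step
  and are less than \<open>h\<close> apart, although \<open>m\<close> keeps
  \<open>m * (a + c)\<close> far from the multiples of \<open>n\<close>.\<close>

lemma not_q_dvd_ac: "\<not> q dvd a + c"
proof
  assume ac: "q dvd a + c"
  obtain m where m: "coprime m n"
    and far: "\<And>w. [w = m * (a + c)] (mod n) \<Longrightarrow> 2 * n \<le> 5 * \<bar>w\<bar>"
    using exists_unit_far[OF n_pos cop6 nz2(2)] by blast
  obtain i where i: "[a * i = 1] (mod q)" by (rule inverse_a)
  define w where "w = (m * (a + b)) mod n"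
  have thr: "(m * a + j * h) mod n < w \<longleftrightarrow> (- (m * c) + j * h) mod n < w" for j
  proof -
    have "q dvd a * i - 1" using i by (simp add: cong_iff_dvd_diff)
    then have "q dvd (a * i - 1) - (a + c) * i" using ac by (simp add: dvd_diff)
    then have "q dvd i * c + 1" by (simp add: algebra_simps dvd_diff_commute)
       (metis add.commute dvd_minus_iff minus_diff_eq diff_minus_eq_add)
    then have "q * h dvd (i * c + 1) * h" by (simp add: mult_dvd_mono)
    then have "n dvd (- j) * ((i * c + 1) * h)" by (simp add: n_eq)
    moreover have "(- (m * c) - j * i * c * h) - (- (m * c) + j * h) = (- j) * ((i * c + 1) * h)"
      by (simp add: algebra_simps)
    ultimately have "(- (m * c) - j * i * c * h) mod n = (- (m * c) + j * h) mod n"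
      by (simp only: mod_eq_dvd_iff)
    then show ?thesis using threshold[OF m i, of j] by (simp only: w_def)
  qed
  obtain h' where h': "n = p * h'" using pn by (rule dvdE)
  have p0: "p > 0" using prime_gt_0_int[OF p] .
  have "h' > 0" using h' n_pos p0 by (simp add: zero_less_mult_iff)
  have "h \<le> h'"
  proof (rule ccontr)
    assume "\<not> h \<le> h'"
    then have "p * h' < q * h" using p_le_q p0 \<open>h' > 0\<close> by (intro mult_le_less_imp_less) auto
    then show False using h' n_eq by simp
  qed
  \<comment> \<open>As a nonzero multiple of \<open>h' = n / p\<close>, the residue \<open>w\<close>
    is at least \<open>h'\<close>, hence at least \<open>h\<close>, away from 0 and
    \<open>n\<close>.\<close>
  have "h' dvd a + b" using order_ab h' p0 by simp
  then have "h' dvd w" unfolding w_def using h' by (simp add: dvd_mod)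
  have "\<not> n dvd m * (a + b)" using m nz2(1) by (simp add: coprime_dvd_mult_right_iff coprime_commute)
  then have w: "0 < w" "w < n" using n_pos by (simp_all add: w_def mod_pos_int)
  have "h' \<le> w" using \<open>h' dvd w\<close> w(1) by (rule zdvd_imp_le)
  have "h' dvd n - w" using \<open>h' dvd w\<close> h' by simp
  then have "h' \<le> n - w" using w(2) by (intro zdvd_imp_le) auto
  define r where "r = (m * a) mod h"
  \<comment> \<open>After \<open>j\<close> steps the first point has just passed 0; one step earlier
    its residue \<open>r - h + n\<close> is not below \<open>w\<close>.\<close>
  define j where "j = - ((m * a) div h)"
  have r: "0 \<le> r" "r < h" using h_pos by (auto simp: r_def)
  have rj: "m * a + j * h = r" by (simp add: r_def j_def minus_div_mult_eq_mod)
  have "5 * h \<le> n" unfolding n_eq using q_ge_5 h_pos by (intro mult_right_mono) auto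
  define y where "y = (- (m * c) + j * h) mod n"
  have y: "0 \<le> y" "y < n" using n_pos by (auto simp: y_def)
  have "r mod n = r" using r \<open>5 * h \<le> n\<close> by simp
  then have "y < w" using thr[of j] r \<open>h' \<le> w\<close> \<open>h \<le> h'\<close> by (simp add: rj y_def)
  have "m * a + (j - 1) * h = r - h" using rj by (simp add: algebra_simps)
  moreover have "(r - h) mod n = r - h + n"
  proof -
    have "(r - h) mod n = (r - h + n) mod n" by simp
    then show ?thesis using r \<open>5 * h \<le> n\<close> by (simp del: mod_add_self2)
  qed
  ultimately have "\<not> (- (m * c) + (j - 1) * h) mod n < w"
    using thr[of "j - 1"] r \<open>h \<le> h'\<close> \<open>h' \<le> n - w\<close> by simp
  moreover have "(- (m * c) + (j - 1) * h) mod n = (y - h) mod n"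
    by (simp add: y_def mod_simps algebra_simps)
  \<comment> \<open>If \<open>y\<close> were at least \<open>h\<close>, the preceding point
    \<open>y - h\<close> would be below \<open>w\<close> as well.\<close>
  moreover have "(y - h) mod n = y - h" if "h \<le> y" using that y h_pos by simp
  ultimately have "y < h" using \<open>y < w\<close> h_pos by (cases "h \<le> y") auto
  have "[r - y = (m * a + j * h) - (- (m * c) + j * h)] (mod n)"
    unfolding rj y_def by (intro cong_diff) auto
  then have "[r - y = m * (a + c)] (mod n)" by (simp add: algebra_simps)
  then have "2 * n \<le> 5 * \<bar>r - y\<bar>" by (rule far)
  moreover have "\<bar>r - y\<bar> < h" using r y \<open>y < h\<close> by (simp add: abs_less_iff)
  ultimately show False using \<open>5 * h \<le> n\<close> n_pos by (smt (verit))
qed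

text \<open>Comparison with \<open>w\<close> identifies two arcs modulo \<open>q\<close> under the
  multiplier \<open>- c / a\<close>, which must be 1 or -1. So \<open>q\<close> divides
  \<open>a + c\<close> or \<open>a - c\<close>, in the latter case also \<open>a + d\<close>; both
  are excluded.\<close>

lemma arc_quad_false: False
proof -
  obtain m where m: "coprime m n"
    and far: "\<And>w. [w = m * (a + b)] (mod n) \<Longrightarrow> 2 * n \<le> 5 * \<bar>w\<bar>"
    using exists_unit_far[OF n_pos cop6 nz2(1)] by blast
  obtain i where i: "[a * i = 1] (mod q)" by (rule inverse_a)
  define w where "w = (m * (a + b)) mod n"
  have w: "0 \<le> w" "w < n" using n_pos by (auto simp: w_def)
  have w1: "2 * n \<le> 5 * w" using far[of w] w by (simp add: w_def)
  have "[w - n = m * (a + b)] (mod n)" by (simp add: w_def cong_def)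
  then have w2: "2 * n \<le> 5 * (n - w)" using far[of "w - n"] w by simp
  have "5 * h \<le> n" unfolding n_eq using q_ge_5 h_pos by (intro mult_right_mono) auto
  have w3: "2 * h \<le> w" "w \<le> (q - 2) * h" using w1 w2 \<open>5 * h \<le> n\<close> n_eq by (simp_all add: algebra_simps)
  define r s where "r = (m * a) mod h" and "s = (- (m * c)) mod h"
  define u v where "u = (m * a) div h" and "v = (- (m * c)) div h"
  have rs: "0 \<le> r" "r < h" "0 \<le> s" "s < h" using h_pos by (auto simp: r_def s_def)
  have ru: "m * a = h * u + r" "- (m * c) = h * v + s" by (simp_all add: r_def s_def u_def v_def)
  obtain T where T: "\<And>i. h * i + r < w \<longleftrightarrow> i < T"
    using threshold_index[OF h_pos rs(1,2) w3] by blast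
  obtain T' where T': "2 \<le> T'" "T' \<le> q - 2" "\<And>i. h * i + s < w \<longleftrightarrow> i < T'"
    using threshold_index[OF h_pos rs(3,4) w3] by blast
  have "q dvd - (i * c) - 1 \<or> q dvd - (i * c) + 1"
  proof (rule arc_multiplier[OF q _ T'(1,2)])
    have "\<not> q dvd i"
    proof
      assume "q dvd i"
      then have "q dvd 1" using i by (meson cong_dvd_iff dvd_mult)
      then show False using q not_prime_unit by blast
    qed
    then show "\<not> q dvd - (i * c)" using nq(1) prime_dvd_mult_iff[OF q] by simp
    fix l
    have "m * a + (l - u) * h = h * l + r" unfolding ru(1) by (simp add: algebra_simps)
    then have 1: "(m * a + (l - u) * h) mod n = h * (l mod q) + r"
      using mod_mult_offset[OF h_pos _ rs(1,2), of q l] q_ge_5 n_eq by simp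
    have "- (m * c) - (l - u) * i * c * h = h * (- (i * c) * l + (i * c * u + v)) + s"
      unfolding ru(2) by (simp add: algebra_simps)
    then have 2: "(- (m * c) - (l - u) * i * c * h) mod n = h * ((- (i * c) * l + (i * c * u + v)) mod q) + s"
      using mod_mult_offset[OF h_pos _ rs(3,4), of q] q_ge_5 n_eq by simp
    show "l mod q < T \<longleftrightarrow> (- (i * c) * l + (i * c * u + v)) mod q < T'"
      using threshold[OF m i, of "l - u"] unfolding w_def[symmetric] 1 2 T T'(3) .
  qed
  then have "q dvd i * (a + c) \<or> q dvd i * (a - c)"
  proof
    have 3: "q dvd a * i - 1" using i by (simp add: cong_iff_dvd_diff)
    { assume "q dvd - (i * c) - 1"
      then have "q dvd (a * i - 1) - (- (i * c) - 1)" using 3 by (rule dvd_diff[rotated])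
      then show ?thesis by (simp add: algebra_simps) }
    { assume "q dvd - (i * c) + 1"
      then have "q dvd (a * i - 1) + (- (i * c) + 1)" using 3 by (rule dvd_add[rotated])
      then show ?thesis by (simp add: algebra_simps) }
  qed
  then have "q dvd a * (i * (a + c)) \<or> q dvd a * (i * (a - c))" by (meson dvd_mult)
  moreover have "[a * (i * x) = x] (mod q)" for x
    using cong_mult[OF i cong_refl, of x] by (simp add: mult.assoc)
  ultimately have "q dvd a + c \<or> q dvd a - c" by (meson cong_dvd_iff)
  then show False
  proof
    assume "q dvd a + c"
    then show False using not_q_dvd_ac by simp
  next
    assume ac: "q dvd a - c"
    have "q dvd a + b + c + d" using sum0 n_eq by (metis dvd_mult_left)
    then have "q dvd (a + b + c + d) - (a + b) + (a - c)" using q_ab ac by (meson dvd_add dvd_diff)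
    then have "q dvd a + d" by (simp add: algebra_simps)
    then show False using arc_quad.not_q_dvd_ac[OF arc_swap] by simp
  qed
qed

end

section \<open>The case of a prime order\<close>

lemma le_div_iff_int: "k \<le> x div n \<longleftrightarrow> k * n \<le> x" if "n > 0" for k x n :: int
proof
  assume "k \<le> x div n"
  then have "k * n \<le> x div n * n" using that by (intro mult_right_mono) auto
  then show "k * n \<le> x" using pos_mod_sign[OF that, of x] div_mult_mod_eq[of x n] by linarith
next
  assume "k * n \<le> x"
  then have "(k * n) div n \<le> x div n" using that by (intro zdiv_mono1) auto
  then show "k \<le> x div n" using that by simp
qed

lemma ceiling_int:
  fixes x C :: int
  assumes "C > 0"
  obtains s where "x \<le> s * C" "(s - 1) * C < x"
proof -
  define s where "s = - ((- x) div C)"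
  have "- s * C \<le> - x" using le_div_iff_int[OF assms, of "- s" "- x"] by (simp add: s_def)
  moreover have "\<not> (- s + 1) * C \<le> - x" using le_div_iff_int[OF assms, of "- s + 1" "- x"] by (simp add: s_def)
  ultimately show ?thesis using that[of s] by (simp add: algebra_simps)
qed

text \<open>
  The jumps of \<open>t * A div n\<close> are those of the other two quotients together. At the first jump \<open>t\<close> of
  \<open>t * D div n\<close>, the enclosing jumps \<open>s < t < u\<close> of \<open>t * C div n\<close> give three jumps of the first quotient
  between \<open>s\<close> and \<open>u\<close>, but \<open>u - s\<close> is too short for that when \<open>2 * A < n\<close>.
\<close>

lemma floor_split_false:
  fixes n A C D :: int
  assumes odd: "odd n" and D: "2 \<le> D" "D \<le> C" and A: "A + 1 = C + D" "2 * A < n"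
    and split: "\<And>t. 1 \<le> t \<Longrightarrow> t < n \<Longrightarrow> (t * C) div n + (t * D) div n = (t * A) div n"
  shows False
proof -
  have pos: "n > 0" "C > 0" "D > 0" "A > 0" using D A by auto
  have small: "C < n" "D < n" using A D by auto
  note le = le_div_iff_int[OF pos(1)]
  obtain t where t: "n \<le> t * D" "(t - 1) * D < n" using ceiling_int[OF pos(3)] .
  have t2: "2 \<le> t"
  proof (rule ccontr)
    assume "\<not> 2 \<le> t"
    then have "t * D \<le> 1 * D" using pos by (intro mult_right_mono) auto
    then show False using t small by simp
  qed
  have "(t - 1) * 2 \<le> (t - 1) * D" using t2 D by (intro mult_left_mono) auto
  then have "(t - 1) * 2 < n" using t by simp
  then have tn: "2 * t \<le> n + 1" using odd by presburger
  have "t < n" using tn t2 A D by simp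
  have E1: "(t * D) div n \<ge> 1" using t le[of 1] by simp
  have E0: "(s * D) div n = 0" if "0 \<le> s" "s < t" for s
  proof -
    have "s * D \<le> (t - 1) * D" using that pos by (intro mult_right_mono) auto
    then have "s * D < n" using t(2) by linarith
    moreover have "0 \<le> s * D" using that pos by simp
    ultimately have "s * D < n" "0 \<le> s * D" .
    then show ?thesis by simp
  qed
  define h where "h = (t * C) div n"
  have "t * D \<le> t * C" using D t2 by simp
  then have h1: "h \<ge> 1" unfolding h_def using le[of 1] t(1) by simp
  \<comment> \<open>As \<open>A < n\<close>, the quotient of \<open>A\<close> rises by at most 1 in
    a step. That of \<open>D\<close> rises at \<open>t\<close>, so that of \<open>C\<close> does
    not.\<close>
  have G: "(t * A) div n \<le> ((t - 1) * A) div n + 1"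
  proof -
    have "t * A \<le> (t - 1) * A + 1 * n" using A D pos by (simp add: algebra_simps)
    then have "(t * A) div n \<le> ((t - 1) * A + 1 * n) div n" using pos by (intro zdiv_mono1) auto
    then show ?thesis using pos by simp
  qed
  have "((t - 1) * C) div n \<le> h" unfolding h_def using pos by (intro zdiv_mono1) auto
  moreover have "h + (t * D) div n = (t * A) div n" using split[of t] t2 \<open>t < n\<close> by (simp add: h_def)
  moreover have "((t - 1) * C) div n + 0 = ((t - 1) * A) div n"
    using split[of "t - 1"] E0[of "t - 1"] t2 \<open>t < n\<close> by simp
  ultimately have hp: "((t - 1) * C) div n = h" "(t * D) div n = 1" using G E1 by auto
  have "C \<noteq> D"
  proof
    assume "C = D"
    then show False using hp(1) E0[of "t - 1"] t2 h1 by simp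
  qed
  then have C3: "C \<ge> 3" using D by simp
  have hn: "h * n \<le> (t - 1) * C" "h * n \<le> t * C"
    using le[of h "(t - 1) * C"] le[of h "t * C"] hp(1) h_def by simp_all
  have "\<not> (h + 1) * n \<le> t * C" using le[of "h + 1" "t * C"] by (simp add: h_def)
  \<comment> \<open>By \<open>2 * t \<le> n + 1\<close>, \<open>h\<close> is small enough for the
    quotient of \<open>C\<close> to reach \<open>h + 1\<close> before \<open>n\<close>.\<close>
  have "2 * (h * n) \<le> (2 * t) * C" using hn by simp
  also have "\<dots> \<le> (n + 1) * C" using tn pos by (intro mult_right_mono) auto
  also have "\<dots> < n * (C + 1)" using small by (simp add: algebra_simps)
  finally have "n * (2 * h) < n * (C + 1)" by (simp add: algebra_simps)
  then have "2 * h < C + 1" using pos by (simp add: mult_less_cancel_left)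
  then have "h + 1 \<le> C - 1" using C3 by simp
  then have "(h + 1) * n \<le> (C - 1) * n" using pos by (intro mult_right_mono) auto
  then have hC: "(h + 1) * n \<le> (n - 1) * C" using small by (simp add: algebra_simps)
  obtain s where s: "h * n \<le> s * C" "(s - 1) * C < h * n" using ceiling_int[OF pos(2)] .
  obtain u where u: "(h + 1) * n \<le> u * C" "(u - 1) * C < (h + 1) * n" using ceiling_int[OF pos(2)] .
  have cancel: "x < y" if "x * C < y * C" for x y using that pos by (simp add: mult_less_cancel_right)
  have "(s - 1) * C < (t - 1) * C" using s hn by simp
  then have st: "s < t" using cancel[of "s - 1" "t - 1"] by simp
  have "t * C < u * C" using \<open>\<not> (h + 1) * n \<le> t * C\<close> u by simp
  then have tu: "t < u" using cancel by blast
  have "(u - 1) * C < (n - 1) * C" using u hC by simp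
  then have un: "u < n" using cancel[of "u - 1" "n - 1"] by simp
  have "0 < h * n" using h1 pos by simp
  then have "0 < s * C" using s(1) by linarith
  then have s1: "s \<ge> 1" using pos by (simp add: zero_less_mult_iff)
  \<comment> \<open>Before \<open>s\<close> the quotient of \<open>D\<close> is 0, so those of
    \<open>A\<close> and \<open>C\<close> agree.\<close>
  have before: "(s - 1) * A < h * n"
  proof (cases "s = 1")
    case True
    then show ?thesis using h1 pos by simp
  next
    case False
    then have "((s - 1) * A) div n = ((s - 1) * C) div n"
      using split[of "s - 1"] E0[of "s - 1"] s1 st \<open>t < n\<close> by simp
    then show ?thesis using s(2) le[of h "(s - 1) * C"] le[of h "(s - 1) * A"] by linarith
  qed
  have "h + 1 \<le> (u * C) div n" using u(1) le by simp
  moreover have "1 \<le> (u * D) div n"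
  proof -
    have "t * D \<le> u * D" using tu pos by simp
    then show ?thesis using t(1) le[of 1] by simp
  qed
  ultimately have "h + 2 \<le> (u * A) div n" using split[of u] un tu t2 by simp
  then have after: "(h + 2) * n \<le> u * A" using le by simp
  \<comment> \<open>Both \<open>v * C\<close> and \<open>v * D\<close> are below \<open>n\<close>,
    so \<open>split\<close> gives \<open>v * A < n\<close>; but \<open>before\<close> and
    \<open>after\<close> require \<open>(v + 2) * A > 2 * n\<close>, against
    \<open>2 * A < n\<close>.\<close>
  define v where "v = u - 1 - s"
  have v1: "v \<ge> 1" using st tu by (simp add: v_def)
  have "v * C < n" using s(1) u(2) by (simp add: v_def algebra_simps)
  moreover have "v * D \<le> v * C" using v1 D by simp
  moreover have "0 \<le> v * C" "0 \<le> v * D" using v1 pos by simp_all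
  ultimately have "(v * C) div n = 0" "(v * D) div n = 0" by (simp_all only: div_pos_pos_trivial le_less_trans)
  then have "(v * A) div n = 0" using split[of v] v1 un s1 by (simp add: v_def)
  then have "v * A < n" using le[of 1 "v * A"] by simp
  moreover have "2 * n < v * A + 2 * A" using before after by (simp add: v_def algebra_simps)
  ultimately show False using A(2) by simp
qed

text \<open>Replacing the large \<open>B\<close> by \<open>A = n - B\<close> turns the quotient sum
  \<open>t - 1\<close> into the splitting of the quotient of \<open>A\<close>;
  \<open>2 * A < n\<close> holds as \<open>n\<close> is odd.\<close>

lemma floor_sum_false:
  fixes n B C D :: int
  assumes odd: "odd n" and n: "n > 2" and B2: "2 \<le> B" "2 \<le> C" "2 \<le> D" and sum: "B + C + D = n + 1"
    and nd: "\<And>t. 1 \<le> t \<Longrightarrow> t < n \<Longrightarrow> \<not> n dvd t * B"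
    and floors: "\<And>t. 1 \<le> t \<Longrightarrow> t < n \<Longrightarrow> (t * B) div n + (t * C) div n + (t * D) div n = t - 1"
    and large: "n \<le> 2 * B"
  shows False
proof -
  define A where "A = n - B"
  have split: "(t * C) div n + (t * D) div n = (t * A) div n" if t: "1 \<le> t" "t < n" for t
  proof -
    have "(t * A) div n = (- (t * B) + t * n) div n" by (simp add: A_def algebra_simps)
    also have "\<dots> = t + (- (t * B)) div n" by (rule div_mult_self1) (use n in simp)
    also have "(- (t * B)) div n = - ((t * B) div n) - 1"
      using nd[OF t] n by (simp add: zdiv_zminus1_eq_if dvd_eq_mod_eq_0)
    finally show ?thesis using floors[OF t] by simp
  qed
  have "n \<noteq> 2 * B" using odd by auto
  then have A: "2 * A < n" "A + 1 = C + D" using large sum by (auto simp: A_def)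
  show False
  proof (cases "D \<le> C")
    case True
    then show False using floor_split_false[OF odd B2(3) _ A(2,1)] split by blast
  next
    case False
    then have "C \<le> D" by simp
    then show False using floor_split_false[OF odd B2(2) _ _ A(1), of D] A(2) split by (simp add: add.commute)
  qed
qed

context balanced_quad begin

text \<open>Dividing by \<open>a\<close> makes the first term 1, and the others, negated, become
  \<open>f b\<close>, \<open>f c\<close>, \<open>f d\<close> with sum \<open>n + 1\<close>. The
  residue sums then say that the quotients of their \<open>t\<close>-fold multiples by
  \<open>n\<close> add up to \<open>t - 1\<close>.\<close>

lemma not_prime: "\<not> Factorial_Ring.prime n"
proof
  assume pr: "Factorial_Ring.prime n"
  have n5: "n \<ge> 5" using prime_ge_5_int[OF pr _ cop6] by simp
  have odd: "odd n" using odd_ge_5(1)[OF _ cop6 n_gt_1] by simp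
  obtain i where i: "[a * i = 1] (mod n)" using cop_a cong_solve_coprime_int by blast
  have ndi: "\<not> n dvd i"
  proof
    assume "n dvd i"
    then have "n dvd 1" using i by (meson cong_dvd_iff dvd_mult)
    then show False using pr not_prime_unit by blast
  qed
  define f where "f x = n - (i * x) mod n" for x
  have unit: "coprime (t * i) n" if "1 \<le> t" "t < n" for t
  proof -
    have "\<not> n dvd t * i" using that ndi prime_dvd_mult_iff[OF pr] zdvd_not_zless by auto
    then show ?thesis using pr prime_imp_coprime coprime_commute by blast
  qed
  have f: "\<not> n dvd t * f x" "(t * i * x) mod n = n - (t * f x) mod n" "2 \<le> f x"
    if x: "\<not> n dvd x" "\<not> n dvd a + x" and t: "1 \<le> t" "t < n" for t x
  proof -
    have cong: "[t * f x = - (t * i * x)] (mod n)"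
    proof -
      have "[n - (i * x) mod n = 0 - i * x] (mod n)" by (intro cong_diff) (auto simp: cong_def)
      then have "[t * f x = t * (- (i * x))] (mod n)" unfolding f_def by (intro cong_mult) auto
      then show ?thesis by (simp add: mult.assoc)
    qed
    have ndx: "\<not> n dvd t * i * x"
      using unit[OF t] x(1) by (simp add: coprime_dvd_mult_right_iff coprime_commute)
    then show "\<not> n dvd t * f x" using cong by (meson cong_dvd_iff dvd_minus_iff)
    have "(t * f x) mod n = (- (t * i * x)) mod n" using cong by (simp add: cong_def)
    also have "\<dots> = n - (t * i * x) mod n" using ndx by (simp add: zmod_zminus1_eq_if dvd_eq_mod_eq_0)
    finally show "(t * i * x) mod n = n - (t * f x) mod n" by simp
    have "f x > 0" using n_pos by (simp add: f_def)
    \<comment> \<open>The value 1 would mean that \<open>n\<close> divides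
      \<open>a + x\<close>.\<close>
    moreover have "f x \<noteq> 1"
    proof
      assume "f x = 1"
      then have "(i * x) mod n = (- 1) mod n" using n_gt_1 by (simp add: f_def zmod_minus1)
      then have "[i * x = - 1] (mod n)" by (simp add: cong_def)
      then have "[a * i + i * x = 1 + - 1] (mod n)" using i by (intro cong_add) auto
      then have "n dvd i * (a + x)" by (simp add: cong_0_iff algebra_simps)
      then show False using ndi x(2) prime_dvd_mult_iff[OF pr] by simp
    qed
    ultimately show "2 \<le> f x" by simp
  qed
  have sum: "(t * f b) mod n + (t * f c) mod n + (t * f d) mod n = n + t" if t: "1 \<le> t" "t < n" for t
  proof -
    have "[t * (a * i) = t * 1] (mod n)" using i by (intro cong_mult) auto
    then have "(t * i * a) mod n = t" using t by (simp add: cong_def ac_simps)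
    moreover have "\<not> n dvd t * i * x" if "\<not> n dvd x" for x
      using unit[OF t] that by (simp add: coprime_dvd_mult_right_iff coprime_commute)
    moreover have "\<not> n dvd a" using not_dvd_a[OF pr] by simp
    ultimately have "t + (t * i * b) mod n + (t * i * c) mod n + (t * i * d) mod n = 2 * n"
      using saw_sum[OF unit[OF t]] nz by (simp add: saw_def)
    then show ?thesis using f(2)[OF nz(1) nz2(1) t] f(2)[OF nz(2) nz2(2) t] f(2)[OF nz(3) nz2(3) t] by simp
  qed
  have f2: "2 \<le> f b" "2 \<le> f c" "2 \<le> f d" using f(3)[of _ 1] nz nz2 n5 by simp_all
  have fn: "f x < n" if "\<not> n dvd x" for x
  proof -
    have "\<not> n dvd i * x" using that ndi prime_dvd_mult_iff[OF pr] by simp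
    then show ?thesis using mod_pos_int[OF n_pos] by (simp add: f_def)
  qed
  have tot: "f b + f c + f d = n + 1" using sum[of 1] f2 fn nz n5 by simp
  have floors: "(t * f b) div n + (t * f c) div n + (t * f d) div n = t - 1" if t: "1 \<le> t" "t < n" for t
  proof -
    have "t * f b + t * f c + t * f d = t * (n + 1)" using tot by (simp add: distrib_left[symmetric])
    moreover have "t * f x = n * ((t * f x) div n) + (t * f x) mod n" for x by simp
    ultimately have "n * ((t * f b) div n + (t * f c) div n + (t * f d) div n) = n * (t - 1)"
      using sum[OF t] unfolding distrib_left right_diff_distrib by (smt (verit) mult.commute mult.right_neutral)
    then show ?thesis using n_pos by simp
  qed
  \<comment> \<open>At \<open>t = 2\<close> the quotients sum to 1, so they are not all 0.\<close>
  have "n \<le> 2 * f b \<or> n \<le> 2 * f c \<or> n \<le> 2 * f d"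
  proof (rule ccontr)
    assume "\<not> ?thesis"
    then have "(2 * f b) div n = 0" "(2 * f c) div n = 0" "(2 * f d) div n = 0" using f2 by auto
    then show False using floors[of 2] n5 by simp
  qed
  moreover have "\<not> n \<le> 2 * f b"
    using floor_sum_false[OF odd _ f2 tot f(1)[OF nz(1) nz2(1)] floors] n5 by auto
  moreover have "\<not> n \<le> 2 * f c"
    using floor_sum_false[OF odd _ f2(2,1,3) _ f(1)[OF nz(2) nz2(2)]] floors tot n5 by (auto simp: algebra_simps)
  moreover have "\<not> n \<le> 2 * f d"
    using floor_sum_false[OF odd _ f2(3,1,2) _ f(1)[OF nz(3) nz2(3)]] floors tot n5 by (auto simp: algebra_simps)
  ultimately show False by blast
qed

end

section \<open>Divisibility by several primes\<close>

context balanced_quad begin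

lemma pair_any_not_dvd:
  assumes q: "Factorial_Ring.prime q" "q dvd n"
    and P: "n dvd q * (a + b) \<or> n dvd q * (a + c) \<or> n dvd q * (a + d)"
  shows "\<not> q dvd b" "\<not> q dvd c" "\<not> q dvd d"
proof -
  interpret c: balanced_quad n a c b d by (rule swap_bc)
  interpret cd: balanced_quad n a c d b by (rule c.swap_cd)
  interpret d: balanced_quad n a d c b by (rule cd.swap_bc)
  show "\<not> q dvd b" "\<not> q dvd c" "\<not> q dvd d"
    using P pair_not_dvd[OF q] c.pair_not_dvd[OF q] d.pair_not_dvd[OF q] by blast+
qed

lemma dvd_of_two_primes:
  assumes "Factorial_Ring.prime p" "Factorial_Ring.prime q" "p \<noteq> q" "n dvd p * x" "n dvd q * x"
  shows "n dvd x"
proof -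
  have "coprime p q" using assms(1-3) primes_coprime by blast
  then have "gcd (p * x) (q * x) dvd x" by (simp add: gcd_mult_right coprime_iff_gcd_eq_1 gcd.commute)
  then show ?thesis using assms(4,5) by (meson dvd_trans gcd_greatest)
qed

lemma prime_dvd_of_single:
  assumes "Factorial_Ring.prime p" "Factorial_Ring.prime q" "p \<noteq> q" "n dvd p * x" "q dvd n"
  shows "q dvd x"
proof -
  have "q dvd p * x" using assms(4,5) dvd_trans by blast
  then show ?thesis using assms(1-3) by (metis prime_dvd_mult_iff primes_dvd_imp_eq)
qed

end

section \<open>Reduced quadruples\<close>

text \<open>The case \<open>n dvd p * a\<close> is absent: as \<open>a\<close> is a unit, it would
  make \<open>n\<close> prime.\<close>

locale reduced_quad = balanced_quad +
  assumes reduced: "Factorial_Ring.prime p \<Longrightarrow> p dvd n \<Longrightarrow>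
    n dvd p * b \<or> n dvd p * c \<or> n dvd p * d \<or>
    n dvd p * (a + b) \<or> n dvd p * (a + c) \<or> n dvd p * (a + d)"
begin

lemma reduced_swap_bc: "reduced_quad n a c b d"
proof -
  interpret s: balanced_quad n a c b d by (rule swap_bc)
  show ?thesis by unfold_locales (use reduced in blast)
qed

lemma reduced_swap_cd: "reduced_quad n a b d c"
proof -
  interpret s: balanced_quad n a b d c by (rule swap_cd)
  show ?thesis by unfold_locales (use reduced in blast)
qed

text \<open>A third prime divides \<open>b\<close>, so it cannot be of pair type; being single, it
  conflicts with the orders of \<open>b\<close> and \<open>c\<close> or with
  \<open>\<not> q dvd d\<close>. Hence \<open>n = p * q\<close>, and both primes would be 5.\<close>

lemma not_single_single:
  assumes p: "Factorial_Ring.prime p" "p dvd n" and q: "Factorial_Ring.prime q" "q dvd n" and "p \<noteq> q"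
    and b: "n dvd p * b" and c: "n dvd q * c"
  shows False
proof -
  interpret c: balanced_quad n a c b d by (rule swap_bc)
  have pp: "\<not> p * p dvd n" using not_single_square[OF p(1)] b by blast
  have qq: "\<not> q * q dvd n" using c.not_single_square[OF q(1)] c by blast
  have qd: "\<not> q dvd d" using two_singles_not_dvd[OF p(1) q qq \<open>p \<noteq> q\<close> b c] .
  have only: "r = p \<or> r = q" if r: "Factorial_Ring.prime r" "r dvd n" for r
  proof (rule ccontr)
    assume neg: "\<not> ?thesis"
    have "r dvd b" using prime_dvd_of_single[OF p(1) r(1) _ b r(2)] neg by blast
    then have "n dvd r * b \<or> n dvd r * c \<or> n dvd r * d"
      using reduced[OF r] pair_any_not_dvd[OF r] by blast
    moreover have "\<not> n dvd r * b" using dvd_of_two_primes[OF p(1) r(1) _ b] nz(1) neg by blast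
    moreover have "\<not> n dvd r * c" using dvd_of_two_primes[OF q(1) r(1) _ c] nz(2) neg by blast
    moreover have "\<not> n dvd r * d" using prime_dvd_of_single[OF r(1) q(1) _ _ q(2)] qd neg by blast
    ultimately show False by blast
  qed
  have "coprime p q" using p q \<open>p \<noteq> q\<close> primes_coprime by blast
  then have "p * q dvd n" using p q divides_mult by blast
  then obtain h where h: "n = p * q * h" by (rule dvdE)
  have "is_unit h"
  proof (rule ccontr)
    assume "\<not> is_unit h"
    moreover have "h \<noteq> 0" using h n_pos by auto
    ultimately obtain r where r: "Factorial_Ring.prime r" "r dvd h" using prime_divisor_exists by blast
    then have "r = p \<or> r = q" using only h by simp
    then show False
    proof
      assume "r = p"
      then have "p * p dvd p * h" using r by simp
      then have "p * p dvd n" using h by (metis dvd_mult2 mult.assoc mult.commute)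
      then show False using pp by simp
    next
      assume "r = q"
      then have "q * q dvd q * h" using r by simp
      then have "q * q dvd n" using h by (metis dvd_mult mult.assoc)
      then show False using qq by simp
    qed
  qed
  moreover have "p * q > 0" using prime_gt_0_int[OF p(1)] prime_gt_0_int[OF q(1)] by simp
  then have "h > 0" using h n_pos zero_less_mult_pos by blast
  ultimately have n: "n = p * q" "n = q * p" using h by simp_all
  have "q \<le> 5" using two_singles_le_5[OF p(1) q(1) \<open>p \<noteq> q\<close> n(1) b c] .
  moreover have "p \<le> 5" using c.two_singles_le_5[OF q(1) p(1) _ n(2) c b] \<open>p \<noteq> q\<close> by simp
  moreover have "p \<ge> 5" "q \<ge> 5" using prime_ge_5_int[OF p cop6] prime_ge_5_int[OF q cop6] .
  ultimately show False using \<open>p \<noteq> q\<close> by simp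
qed

text \<open>As \<open>n\<close> is neither prime nor divisible by \<open>p * p\<close>, it has
  another prime \<open>q\<close>. This divides \<open>b\<close>, so it is single, but no term can
  have order \<open>q\<close>.\<close>

lemma not_single:
  assumes p: "Factorial_Ring.prime p" "p dvd n"
  shows "\<not> n dvd p * b"
proof
  assume b: "n dvd p * b"
  interpret d: reduced_quad n a b d c by (rule reduced_swap_cd)
  have pp: "\<not> p * p dvd n" using not_single_square[OF p(1)] b by blast
  obtain h where h: "n = p * h" using p(2) by (rule dvdE)
  have "\<not> is_unit h"
  proof
    assume "is_unit h"
    then have "n = p" using h n_pos prime_gt_0_int[OF p(1)] by (auto simp: zero_less_mult_iff)
    then show False using p(1) not_prime by simp
  qed
  moreover have "h \<noteq> 0" using h n_pos by auto
  ultimately obtain q where q: "Factorial_Ring.prime q" "q dvd h" using prime_divisor_exists by blast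
  have "p \<noteq> q" using q pp h by auto
  have qn: "q dvd n" using q h by simp
  have "q dvd b" using prime_dvd_of_single[OF p(1) q(1) \<open>p \<noteq> q\<close> b qn] .
  then have "n dvd q * b \<or> n dvd q * c \<or> n dvd q * d"
    using reduced[OF q(1) qn] pair_any_not_dvd[OF q(1) qn] by blast
  moreover have "\<not> n dvd q * b" using dvd_of_two_primes[OF p(1) q(1) \<open>p \<noteq> q\<close> b] nz(1) by blast
  ultimately show False
    using not_single_single[OF p q(1) qn \<open>p \<noteq> q\<close> b] d.not_single_single[OF p q(1) qn \<open>p \<noteq> q\<close> b] by blast
qed

lemma all_pairs:
  assumes p: "Factorial_Ring.prime p" "p dvd n"
  shows "n dvd p * (a + b) \<or> n dvd p * (a + c) \<or> n dvd p * (a + d)"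
proof -
  interpret c: reduced_quad n a c b d by (rule reduced_swap_bc)
  interpret cd: reduced_quad n a c d b by (rule c.reduced_swap_cd)
  interpret d: reduced_quad n a d c b by (rule cd.reduced_swap_bc)
  show ?thesis using reduced[OF p] not_single[OF p] c.not_single[OF p] d.not_single[OF p] by blast
qed

text \<open>It remains to treat shifts that are no units, which are multiples of \<open>q\<close>.
  There the terms cancel in pairs since \<open>q\<close> is of pair type, and no product is 0 modulo
  \<open>n\<close> since \<open>p\<close> divides neither the shift nor any term.\<close>

lemma not_pair:
  assumes p: "Factorial_Ring.prime p" "p dvd n" and q: "Factorial_Ring.prime q" "q dvd n"
    and "p \<le> q" and ab: "n dvd p * (a + b)" and pq: "p \<noteq> q \<or> q * q dvd n"
  shows False
proof -
  obtain h where h: "n = q * h" using q(2) by (rule dvdE)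
  have q0: "q > 0" using prime_gt_0_int[OF q(1)] .
  have nd: "\<not> r dvd b" "\<not> r dvd c" "\<not> r dvd d" if "Factorial_Ring.prime r" "r dvd n" for r
    using pair_any_not_dvd[OF that all_pairs[OF that]] .
  have qab: "q dvd a + b"
  proof (cases "p = q")
    case True
    then have "q * q dvd q * (a + b)" using pq ab dvd_trans by blast
    then show ?thesis using q0 by simp
  next
    case False
    then show ?thesis using prime_dvd_of_single[OF p(1) q(1) _ ab q(2)] by blast
  qed
  \<comment> \<open>For \<open>p = q\<close> the prime \<open>q\<close> divides \<open>h\<close>,
    and every shift is a unit.\<close>
  have shift: "coprime l n \<or> q dvd l \<and> p \<noteq> q \<and> \<not> p dvd l" if m: "coprime m n" and l: "l = m + k * h" for m k l
  proof (cases "q dvd l")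
    case False
    then show ?thesis using coprime_shift[OF h n_pos q(1) m] l by simp
  next
    case True
    have mq: "\<not> r dvd m" if "Factorial_Ring.prime r" "r dvd n" for r
      using m that by (meson coprime_common_divisor not_prime_unit)
    have "p \<noteq> q"
    proof
      assume "p = q"
      then have "q * q dvd q * h" using pq h by simp
      then have "q dvd h" using q0 by simp
      then show False using True mq[OF q] l by (simp add: dvd_add_left_iff)
    qed
    moreover have "p dvd h" using \<open>p \<noteq> q\<close> p q(1) h by (metis prime_dvd_mult_iff primes_dvd_imp_eq)
    ultimately show ?thesis using True mq[OF p] l by (simp add: dvd_add_left_iff)
  qed
  have nz_shift: "\<not> n dvd (m + k * h) * x" if m: "coprime m n" and x: "\<not> p dvd x" "\<not> n dvd x" for m k x
    using shift[OF m refl, of k]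
  proof
    assume "coprime (m + k * h) n"
    then show ?thesis using x by (simp add: coprime_dvd_mult_right_iff coprime_commute)
  next
    assume "q dvd (m + k * h) \<and> p \<noteq> q \<and> \<not> p dvd (m + k * h)"
    then have "\<not> p dvd (m + k * h) * x" using x prime_dvd_mult_iff[OF p(1)] by simp
    then show ?thesis using p(2) dvd_trans by blast
  qed
  have saw_shift: "saw n (l * a) + saw n (l * b) + saw n (l * c) + saw n (l * d) = 0"
    if m: "coprime m n" and l: "l = m + k * h" for m k l
  proof (cases "coprime l n")
    case True
    then show ?thesis by (rule saw_sum)
  next
    case False
    then obtain j where j: "l = q * j" using shift[OF m l] by (auto elim: dvdE)
    have pair: "saw n (l * x) + saw n (l * y) = 0" if "n dvd q * (x + y)" for x y
      using saw_cong_neg[OF n_pos, of "l * x" "l * y"] dvd_mult[OF that, of j] by (simp add: j algebra_simps)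
    have rest: "n dvd q * (x + y)" if "n dvd q * (z + w)" "z + w + x + y = a + b + c + d" for x y z w
    proof -
      have "q * (x + y) = q * (a + b + c + d) - q * (z + w)"
        unfolding that(2)[symmetric] by (simp add: algebra_simps)
      then show ?thesis using that(1) sum0 by (metis dvd_diff dvd_mult)
    qed
    show ?thesis using all_pairs[OF q]
    proof (elim disjE)
      assume "n dvd q * (a + b)"
      then show ?thesis using pair[of a b] pair[of c d] rest[of a b c d] by simp
    next
      assume "n dvd q * (a + c)"
      then show ?thesis using pair[of a c] pair[of b d] rest[of a c b d] by simp
    next
      assume "n dvd q * (a + d)"
      then show ?thesis using pair[of a d] pair[of b c] rest[of a d b c] by simp
    qed
  qed
  have "\<not> n dvd a" using not_dvd_a[OF p] p(2) dvd_trans by blast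
  have "arc_quad n a b c d p q h"
    by unfold_locales
      (use p q h \<open>p \<le> q\<close> ab qab nd[OF q] nd[OF p] not_dvd_a[OF p] nz \<open>\<not> n dvd a\<close> nz_shift saw_shift in auto)
  then show False by (rule arc_quad.arc_quad_false)
qed

lemma not_pair_any:
  assumes p: "Factorial_Ring.prime p" "p dvd n" and q: "Factorial_Ring.prime q" "q dvd n"
    and "p \<le> q" and pq: "p \<noteq> q \<or> q * q dvd n"
  shows False
proof -
  interpret c: reduced_quad n a c b d by (rule reduced_swap_bc)
  interpret cd: reduced_quad n a c d b by (rule c.reduced_swap_cd)
  interpret d: reduced_quad n a d c b by (rule cd.reduced_swap_bc)
  show False
    using all_pairs[OF p] not_pair[OF p q \<open>p \<le> q\<close> _ pq] c.not_pair[OF p q \<open>p \<le> q\<close> _ pq]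
      d.not_pair[OF p q \<open>p \<le> q\<close> _ pq] by blast
qed

text \<open>A nonprime \<open>n\<close> has two prime factors counted with multiplicity; they are
  used in increasing order.\<close>

lemma reduced_quad_false: False
proof -
  have "\<not> is_unit n" "n \<noteq> 0" using n_gt_1 by auto
  then obtain p where p: "Factorial_Ring.prime p" "p dvd n" using prime_divisor_exists by blast
  obtain h where h: "n = p * h" using p(2) by (rule dvdE)
  have "\<not> is_unit h"
  proof
    assume "is_unit h"
    then have "n = p" using h n_pos prime_gt_0_int[OF p(1)] by (auto simp: zero_less_mult_iff)
    then show False using p(1) not_prime by simp
  qed
  moreover have "h \<noteq> 0" using h n_pos by auto
  ultimately obtain q where q: "Factorial_Ring.prime q" "q dvd h" using prime_divisor_exists by blast
  have qn: "q dvd n" using q h by simp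
  show False
  proof (cases "p = q")
    case True
    then have "q * q dvd n" using q h by simp
    then show False using not_pair_any[OF p p] True by simp
  next
    case False
    then show False using not_pair_any[OF p q(1) qn] not_pair_any[OF q(1) qn p] by linarith
  qed
qed

end

section \<open>A unit multiple with residue sum \<open>n\<close>\<close>

lemma exists_unit_residue_sum_aux:
  fixes n a b c d :: int
  assumes n: "n > 1" "coprime n 6" and sum: "n dvd a + b + c + d" and cop: "coprime a n"
    and nz: "\<not> n dvd b" "\<not> n dvd c" "\<not> n dvd d"
    and nz2: "\<not> n dvd a + b" "\<not> n dvd a + c" "\<not> n dvd a + d"
    and red: "\<And>p. Factorial_Ring.prime p \<Longrightarrow> p dvd n \<Longrightarrow>
      n dvd p * a \<or> n dvd p * b \<or> n dvd p * c \<or> n dvd p * d \<or>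
      n dvd p * (a + b) \<or> n dvd p * (a + c) \<or> n dvd p * (a + d)"
  shows "\<exists>m. coprime m n \<and> (m * a) mod n + (m * b) mod n + (m * c) mod n + (m * d) mod n = n"
proof (rule ccontr)
  assume "\<not> ?thesis"
  then have ne: "(m * a) mod n + (m * b) mod n + (m * c) mod n + (m * d) mod n \<noteq> n" if "coprime m n" for m
    using that by blast
  have nza: "\<not> n dvd a"
  proof
    assume "n dvd a"
    then have "n dvd 1" using cop by (metis coprime_common_divisor dvd_refl)
    then show False using n(1) by simp
  qed
  have two: "saw n (m * a) + saw n (m * b) + saw n (m * c) + saw n (m * d) = 0" if m: "coprime m n" for m
  proof -
    define r where "r x = (m * x) mod n" for x
    have nd: "\<not> n dvd m * x" if "\<not> n dvd x" for x
      using that m by (simp add: coprime_dvd_mult_right_iff coprime_commute)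
    have r: "0 < r x" "r x < n" if "\<not> n dvd x" for x
      using nd[OF that] n(1) by (simp_all add: r_def mod_pos_int)
    have neg: "(- m * x) mod n = n - r x" if "\<not> n dvd x" for x
      using nd[OF that] by (simp add: r_def zmod_zminus1_eq_if dvd_eq_mod_eq_0)
    have "[r a + r b + r c + r d = m * a + m * b + m * c + m * d] (mod n)"
      unfolding r_def by (intro cong_add) (auto simp: cong_def)
    also have "m * a + m * b + m * c + m * d = m * (a + b + c + d)" by (simp add: distrib_left)
    finally have "n dvd r a + r b + r c + r d" using sum by (meson cong_dvd_iff dvd_mult)
    then obtain k where k: "r a + r b + r c + r d = n * k" by (rule dvdE)
    have "n * 0 < n * k" "n * k < n * 4"
      using k r[OF nza] r[OF nz(1)] r[OF nz(2)] r[OF nz(3)] by linarith+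
    then have "0 < k" "k < 4" using n(1) by (simp_all add: zero_less_mult_iff)
    moreover have "k \<noteq> 1" using ne[OF m] k by (auto simp: r_def)
    moreover have "k \<noteq> 3"
    proof
      assume "k = 3"
      moreover have "coprime (- m) n" using m by simp
      ultimately show False
        using ne[of "- m"] k neg[OF nza] neg[OF nz(1)] neg[OF nz(2)] neg[OF nz(3)] by simp
    qed
    ultimately have "r a + r b + r c + r d = 2 * n" using k by auto
    then show ?thesis
      using nd[OF nza] nd[OF nz(1)] nd[OF nz(2)] nd[OF nz(3)] by (simp add: saw_def r_def)
  qed
  interpret balanced_quad n a b c d
    by unfold_locales (use n sum cop nz nz2 two in blast)+
  interpret reduced_quad n a b c d
  proof unfold_locales
    fix p assume p: "Factorial_Ring.prime p" "p dvd n"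
    have "\<not> n dvd p * a"
    proof
      assume "n dvd p * a"
      then have "n dvd p" using cop by (simp add: coprime_dvd_mult_left_iff coprime_commute)
      then have "n = p" using zdvd_antisym_nonneg[of n p] p(2) n_pos prime_ge_0_int[OF p(1)] by simp
      then show False using p(1) not_prime by simp
    qed
    then show "n dvd p * b \<or> n dvd p * c \<or> n dvd p * d \<or>
      n dvd p * (a + b) \<or> n dvd p * (a + c) \<or> n dvd p * (a + d)" using red[OF p] by blast
  qed
  show False by (rule reduced_quad_false)
qed

lemma exists_unit_residue_sum:
  fixes n a b c d :: int
  assumes n: "n > 1" "coprime n 6" and sum: "n dvd a + b + c + d"
    and cop: "coprime a n \<or> coprime b n \<or> coprime c n \<or> coprime d n"
    and nz: "\<not> n dvd a" "\<not> n dvd b" "\<not> n dvd c" "\<not> n dvd d"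
    and nz2: "\<not> n dvd a + b" "\<not> n dvd a + c" "\<not> n dvd a + d"
    and red: "\<And>p. Factorial_Ring.prime p \<Longrightarrow> p dvd n \<Longrightarrow>
      n dvd p * a \<or> n dvd p * b \<or> n dvd p * c \<or> n dvd p * d \<or>
      n dvd p * (a + b) \<or> n dvd p * (a + c) \<or> n dvd p * (a + d)"
  shows "\<exists>m. coprime m n \<and> (m * a) mod n + (m * b) mod n + (m * c) mod n + (m * d) mod n = n"
proof -
  \<comment> \<open>Complementary pairs have opposite sums modulo \<open>n\<close>, so the
    conditions on pairs containing \<open>a\<close> carry over to any other leading term.\<close>
  have compl: "n dvd k * (z + w) \<longleftrightarrow> n dvd k * (x + y)" if "x + y + z + w = a + b + c + d" for k x y z w
  proof -
    have "k * (z + w) + k * (x + y) = k * (a + b + c + d)"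
      unfolding that[symmetric] by (simp add: algebra_simps)
    then have "n dvd k * (z + w) + k * (x + y)" using sum by simp
    then show ?thesis using dvd_add_left_iff dvd_add_right_iff by blast
  qed
  have cd: "n dvd k * (c + d) \<longleftrightarrow> n dvd k * (a + b)" and bd: "n dvd k * (b + d) \<longleftrightarrow> n dvd k * (a + c)"
    and bc: "n dvd k * (b + c) \<longleftrightarrow> n dvd k * (a + d)" for k
    by (rule compl, simp)+
  note compl1 = cd[of 1, simplified] bd[of 1, simplified] bc[of 1, simplified]
  from cop show ?thesis
  proof (elim disjE)
    assume "coprime a n"
    then show ?thesis
      by (rule exists_unit_residue_sum_aux[OF n sum _ nz(2,3,4) nz2 red])
  next
    assume *: "coprime b n"
    note swap = add.commute[of b a] cd bd bc compl1
    have "n dvd b + a + c + d" using sum by (simp add: ac_simps)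
    then have "\<exists>m. coprime m n \<and> (m * b) mod n + (m * a) mod n + (m * c) mod n + (m * d) mod n = n"
    proof (rule exists_unit_residue_sum_aux[OF n _ *])
      show "\<not> n dvd a" "\<not> n dvd c" "\<not> n dvd d" using nz by blast+
      show "\<not> n dvd b + a" "\<not> n dvd b + c" "\<not> n dvd b + d" unfolding swap using nz2 by blast+
    next
      fix p :: int assume "Factorial_Ring.prime p" "p dvd n"
      then show "n dvd p * b \<or> n dvd p * a \<or> n dvd p * c \<or> n dvd p * d \<or>
        n dvd p * (b + a) \<or> n dvd p * (b + c) \<or> n dvd p * (b + d)"
        unfolding swap using red[of p] by blast
    qed
    then show ?thesis by (simp only: ac_simps)
  next
    assume *: "coprime c n"
    note swap = add.commute[of c a] add.commute[of c b] cd bd bc compl1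
    have "n dvd c + a + b + d" using sum by (simp add: ac_simps)
    then have "\<exists>m. coprime m n \<and> (m * c) mod n + (m * a) mod n + (m * b) mod n + (m * d) mod n = n"
    proof (rule exists_unit_residue_sum_aux[OF n _ *])
      show "\<not> n dvd a" "\<not> n dvd b" "\<not> n dvd d" using nz by blast+
      show "\<not> n dvd c + a" "\<not> n dvd c + b" "\<not> n dvd c + d" unfolding swap using nz2 by blast+
    next
      fix p :: int assume "Factorial_Ring.prime p" "p dvd n"
      then show "n dvd p * c \<or> n dvd p * a \<or> n dvd p * b \<or> n dvd p * d \<or>
        n dvd p * (c + a) \<or> n dvd p * (c + b) \<or> n dvd p * (c + d)"
        unfolding swap using red[of p] by blast
    qed
    then show ?thesis by (simp only: ac_simps)
  next
    assume *: "coprime d n"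
    note swap = add.commute[of d a] add.commute[of d b] add.commute[of d c] cd bd bc compl1
    have "n dvd d + a + b + c" using sum by (simp add: ac_simps)
    then have "\<exists>m. coprime m n \<and> (m * d) mod n + (m * a) mod n + (m * b) mod n + (m * c) mod n = n"
    proof (rule exists_unit_residue_sum_aux[OF n _ *])
      show "\<not> n dvd a" "\<not> n dvd b" "\<not> n dvd c" using nz by blast+
      show "\<not> n dvd d + a" "\<not> n dvd d + b" "\<not> n dvd d + c" unfolding swap using nz2 by blast+
    next
      fix p :: int assume "Factorial_Ring.prime p" "p dvd n"
      then show "n dvd p * d \<or> n dvd p * a \<or> n dvd p * b \<or> n dvd p * c \<or>
        n dvd p * (d + a) \<or> n dvd p * (d + b) \<or> n dvd p * (d + c)"
        unfolding swap using red[of p] by blast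
    qed
    then show ?thesis by (simp only: ac_simps)
  qed
qed

section \<open>Sequences of powers in a cyclic group\<close>

lemma subseteq_add_mset_iff:
  "T \<subseteq># add_mset x S \<longleftrightarrow> T \<subseteq># S \<or> (\<exists>T'. T = add_mset x T' \<and> T' \<subseteq># S)"
proof
  assume T: "T \<subseteq># add_mset x S"
  show "T \<subseteq># S \<or> (\<exists>T'. T = add_mset x T' \<and> T' \<subseteq># S)"
  proof (cases "x \<in># T")
    case True
    then obtain T' where "T = add_mset x T'" by (metis insert_DiffM)
    then show ?thesis using T by auto
  next
    case False
    then show ?thesis using T by (metis diff_single_trivial subset_eq_diff_conv add_mset_add_single)
  qed
qed (auto intro: subset_mset.order_trans)

lemma proper_subset_four:
  fixes a b c d :: "'a :: comm_monoid_add"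
  assumes "T \<subset># {#a, b, c, d#}" "T \<noteq> {#}"
  shows "sum_mset T \<in> {a, b, c, d, a + b, a + c, a + d, b + c, b + d, c + d,
    a + b + c, a + b + d, a + c + d, b + c + d}"
proof -
  have "T \<subseteq># {#a, b, c, d#}" "T \<noteq> {#a, b, c, d#}" using assms(1) by auto
  then show ?thesis using assms(2)
    by (auto simp: subseteq_add_mset_iff add.assoc)
qed

context comm_group begin

lemma seq_sum_empty: "seq_sum G {#} = \<one>"
  by (simp add: seq_sum_def)

lemma seq_sum_add_mset:
  assumes x: "x \<in> carrier G" and S: "set_mset S \<subseteq> carrier G"
  shows "seq_sum G (add_mset x S) = x \<otimes> seq_sum G S"
proof -
  \<comment> \<open>Removing \<open>x\<close> from the support treats old and new terms alike; a new
    one has exponent 0 in \<open>S\<close>.\<close>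
  let ?A = "set_mset S - {x}"
  let ?f = "\<lambda>y. y [^] count S y"
  have f: "?f \<in> ?A \<rightarrow> carrier G" using S by auto
  have "seq_sum G (add_mset x S) = finprod G (\<lambda>y. y [^] count (add_mset x S) y) (insert x ?A)"
    by (simp add: seq_sum_def)
  also have "\<dots> = x [^] Suc (count S x) \<otimes> finprod G (\<lambda>y. y [^] count (add_mset x S) y) ?A"
    using x S by (subst finprod_insert) auto
  also have "finprod G (\<lambda>y. y [^] count (add_mset x S) y) ?A = finprod G ?f ?A"
    using f by (intro finprod_cong') auto
  also have "x [^] Suc (count S x) \<otimes> finprod G ?f ?A = x \<otimes> (x [^] count S x \<otimes> finprod G ?f ?A)"
    using x f by (simp add: m_assoc m_comm m_lcomm)
  also have "x [^] count S x \<otimes> finprod G ?f ?A = seq_sum G S"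
  proof (cases "x \<in># S")
    case True
    then have "seq_sum G S = finprod G ?f (insert x ?A)" by (simp add: seq_sum_def insert_absorb)
    also have "\<dots> = x [^] count S x \<otimes> finprod G ?f ?A"
      using x f by (subst finprod_insert) auto
    finally show ?thesis by simp
  next
    case False
    then show ?thesis using f by (simp add: seq_sum_def not_in_iff)
  qed
  finally show ?thesis .
qed

lemma seq_sum_pow:
  assumes "g \<in> carrier G"
  shows "seq_sum G (image_mset (\<lambda>k::nat. g [^] k) K) = g [^] sum_mset K"
proof (induction K)
  case (add k K)
  have "set_mset (image_mset (\<lambda>k. g [^] k) K) \<subseteq> carrier G" using assms by auto
  then show ?case using add assms by (simp add: seq_sum_add_mset nat_pow_mult)
qed (simp add: seq_sum_empty)

lemma zero_sum_pow_iff: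
  assumes "g \<in> carrier G"
  shows "zero_sum G (image_mset (\<lambda>k::nat. g [^] k) K) \<longleftrightarrow> ord g dvd sum_mset K"
  using assms by (auto simp: zero_sum_def seq_sum_pow pow_eq_id)

text \<open>Distinct exponents may give equal powers, but every splitting of the image lifts to a
  splitting of \<open>K\<close> with nonempty parts.\<close>

lemma minimal_zero_sum_pow_iff:
  assumes "g \<in> carrier G"
  shows "minimal_zero_sum G (image_mset (\<lambda>k::nat. g [^] k) K) \<longleftrightarrow>
    ord g dvd sum_mset K \<and> (\<forall>L. L \<subset># K \<and> L \<noteq> {#} \<longrightarrow> \<not> ord g dvd sum_mset L)"
proof -
  have "(\<forall>T. T \<subset># image_mset (\<lambda>k. g [^] k) K \<and> T \<noteq> {#} \<longrightarrow> \<not> zero_sum G T) \<longleftrightarrow>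
    (\<forall>L. L \<subset># K \<and> L \<noteq> {#} \<longrightarrow> \<not> zero_sum G (image_mset (\<lambda>k. g [^] k) L))" (is "?L \<longleftrightarrow> ?R")
  proof
    assume ?L
    then show ?R by (simp add: image_mset_subset_mono)
  next
    assume R: ?R
    show ?L
    proof (intro allI impI)
      fix T assume T: "T \<subset># image_mset (\<lambda>k. g [^] k) K \<and> T \<noteq> {#}"
      then obtain U where U: "image_mset (\<lambda>k. g [^] k) K = T + U"
        by (metis mset_subset_eq_exists_conv subset_mset.less_imp_le)
      with T have "U \<noteq> {#}" by auto
      from U obtain L M where "K = L + M" "T = image_mset (\<lambda>k. g [^] k) L" "U = image_mset (\<lambda>k. g [^] k) M"
        using image_mset_eq_plusD by metis
      moreover from this have "L \<subset># K" "L \<noteq> {#}"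
        using T \<open>U \<noteq> {#}\<close> by (auto simp: subset_mset.less_le)
      ultimately show "\<not> zero_sum G T" using R by blast
    qed
  qed
  then show ?thesis using assms by (simp add: minimal_zero_sum_def zero_sum_pow_iff)
qed

lemma seq_coeff_in:
  assumes "finite (carrier G)" "h \<in> generators G" "x \<in> carrier G"
  shows "seq_coeff G h x \<in> {1..order G}" "h [^] seq_coeff G h x = x"
  using theI'[OF seq_coeff_unique[OF assms]] by (simp_all add: seq_coeff_def)

lemma seq_coeff_pow:
  assumes "finite (carrier G)" "h \<in> generators G" "m \<in> {1..order G}"
  shows "seq_coeff G h (h [^] m) = m"
proof -
  have "h [^] m \<in> carrier G" using assms(2) by (simp add: generators_def)
  then show ?thesis
    unfolding seq_coeff_def using seq_coeff_unique[OF assms(1,2)] assms(3) by (intro the1_equality) auto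
qed

lemma ord_generator:
  assumes "h \<in> generators G"
  shows "ord h = order G"
  using assms generate_pow_card[of h] by (simp add: generators_def order_def)

lemma generatorI:
  assumes "finite (carrier G)" "h \<in> carrier G" "ord h = order G"
  shows "h \<in> generators G"
proof -
  have "generate G {h} \<subseteq> carrier G" using generate_incl[of "{h}"] assms(2) by simp
  moreover have "card (generate G {h}) = card (carrier G)"
    using generate_pow_card[OF assms(2)] assms(3) by (simp add: order_def)
  ultimately have "generate G {h} = carrier G" using assms(1) card_subset_eq by blast
  then show ?thesis using assms(2) by (simp add: generators_def)
qed

text \<open>The coefficients are positive and their sum is a multiple of the group order.\<close>

lemma seq_norm_ge_1:
  assumes fin: "finite (carrier G)" and h: "h \<in> generators G" and S: "zero_sum G S" "S \<noteq> {#}"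
  shows "seq_norm G h S \<ge> 1"
proof -
  let ?K = "image_mset (seq_coeff G h) S"
  have SG: "set_mset S \<subseteq> carrier G" using S by (simp add: zero_sum_def)
  have "image_mset (\<lambda>k. h [^] k) ?K = image_mset (\<lambda>x. x) S"
    unfolding multiset.map_comp comp_def
    using SG seq_coeff_in(2)[OF fin h] by (intro image_mset_cong) auto
  then have dvd: "order G dvd sum_mset ?K"
    using S(1) zero_sum_pow_iff[of h ?K] h ord_generator[OF h] by (simp add: generators_def)
  obtain x where "x \<in># S" using S(2) by blast
  then have "x \<in> carrier G" using SG by blast
  then have "seq_coeff G h x \<in> {1..order G}" by (rule seq_coeff_in(1)[OF fin h])
  moreover obtain R where "S = add_mset x R" using \<open>x \<in># S\<close> by (rule mset_add)
  ultimately have "sum_mset ?K > 0" by simp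
  then have "order G \<le> sum_mset ?K" using dvd by (rule dvd_imp_le[rotated])
  moreover have "order G > 0" using fin order_gt_0_iff_finite by blast
  ultimately have "1 \<le> rat_of_nat (sum_mset ?K) / of_nat (order G)"
    by (simp only: le_divide_eq_1_pos of_nat_0_less_iff of_nat_le_iff)
  then show ?thesis by (simp only: seq_norm_def)
qed

end

theorem theorem1p4:
  fixes G :: "('a, 'b) monoid_scheme" (structure)
    and g :: 'a and S :: "'a multiset" and n n\<^sub>1 n\<^sub>2 n\<^sub>3 n\<^sub>4 :: nat
  assumes "group G" and "cyclic_group G" and "finite (carrier G)"
    and "n = order G" and "gcd n 6 = 1"
    and "g \<in> carrier G" and "group.ord G g = n"
    and "n\<^sub>1 \<in> {1..n}" and "n\<^sub>2 \<in> {1..n}" and "n\<^sub>3 \<in> {1..n}" and "n\<^sub>4 \<in> {1..n}"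
    and "S = {# g [^] n\<^sub>1, g [^] n\<^sub>2, g [^] n\<^sub>3, g [^] n\<^sub>4 #}"
    and "minimal_zero_sum G S"
    and "reduced_seq G S"
    and "coprime n\<^sub>1 n \<or> coprime n\<^sub>2 n \<or> coprime n\<^sub>3 n \<or> coprime n\<^sub>4 n"
  shows "seq_index G S = 1"
proof -
  interpret group G by fact
  interpret comm_group G using \<open>cyclic_group G\<close> by (rule cyclic_imp_abelian_group)
  note fin = \<open>finite (carrier G)\<close> and g = \<open>g \<in> carrier G\<close>
  have ordg: "ord g = n" by fact
  have S: "S = image_mset (\<lambda>k. g [^] k) {#n\<^sub>1, n\<^sub>2, n\<^sub>3, n\<^sub>4#}" using assms(12) by simp
  have min: "n dvd n\<^sub>1 + n\<^sub>2 + n\<^sub>3 + n\<^sub>4"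
    "\<And>L. L \<subset># {#n\<^sub>1, n\<^sub>2, n\<^sub>3, n\<^sub>4#} \<Longrightarrow> L \<noteq> {#} \<Longrightarrow> \<not> n dvd sum_mset L"
    using assms(13) unfolding S minimal_zero_sum_pow_iff[OF g] ordg by (simp_all add: add.assoc)
  have nz: "\<not> n dvd n\<^sub>1" "\<not> n dvd n\<^sub>2" "\<not> n dvd n\<^sub>3" "\<not> n dvd n\<^sub>4"
    and nz2: "\<not> n dvd n\<^sub>1 + n\<^sub>2" "\<not> n dvd n\<^sub>1 + n\<^sub>3" "\<not> n dvd n\<^sub>1 + n\<^sub>4"
    using min(2)[of "{#n\<^sub>1#}"] min(2)[of "{#n\<^sub>2#}"] min(2)[of "{#n\<^sub>3#}"] min(2)[of "{#n\<^sub>4#}"]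
      min(2)[of "{#n\<^sub>1, n\<^sub>2#}"] min(2)[of "{#n\<^sub>1, n\<^sub>3#}"] min(2)[of "{#n\<^sub>1, n\<^sub>4#}"]
    by (auto simp: subset_mset.less_le subseteq_add_mset_iff)
  have red: "int n dvd p * int n\<^sub>1 \<or> int n dvd p * int n\<^sub>2 \<or> int n dvd p * int n\<^sub>3 \<or> int n dvd p * int n\<^sub>4 \<or>
      int n dvd p * (int n\<^sub>1 + int n\<^sub>2) \<or> int n dvd p * (int n\<^sub>1 + int n\<^sub>3) \<or> int n dvd p * (int n\<^sub>1 + int n\<^sub>4)"
    if p: "Factorial_Ring.prime p" "p dvd int n" for p :: int
  proof -
    obtain r where r: "p = int r" using prime_ge_0_int[OF p(1)] nonneg_int_cases by blast
    let ?K = "{#n\<^sub>1 * r, n\<^sub>2 * r, n\<^sub>3 * r, n\<^sub>4 * r#}"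
    have sum: "n dvd n\<^sub>1 * r + n\<^sub>2 * r + n\<^sub>3 * r + n\<^sub>4 * r"
      using min(1) by (metis distrib_right dvd_mult2)
    have "image_mset (\<lambda>x. x [^] r) S = image_mset (\<lambda>k. g [^] k) ?K"
      unfolding S using g by (simp add: nat_pow_pow)
    moreover have "Factorial_Ring.prime r" "r dvd order G" using p r assms(4) by simp_all
    ultimately have "\<not> minimal_zero_sum G (image_mset (\<lambda>k. g [^] k) ?K)"
      using assms(14) unfolding reduced_seq_def by metis
    then obtain L where L: "L \<subset># ?K" "L \<noteq> {#}" "n dvd sum_mset L"
      unfolding minimal_zero_sum_pow_iff[OF g] ordg using sum by (auto simp: add.assoc)
    \<comment> \<open>Complements of zero sums are zero sums, which reduces the 14 proper subsums to
      single terms and pairs containing the first term.\<close>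
    have compl: "n dvd y" if "n dvd x" "x + y = n\<^sub>1 * r + n\<^sub>2 * r + n\<^sub>3 * r + n\<^sub>4 * r" for x y
      using sum that(1) unfolding that(2)[symmetric] by (simp add: dvd_add_right_iff)
    have pairs: "n dvd n\<^sub>2 * r + n\<^sub>3 * r \<Longrightarrow> n dvd n\<^sub>1 * r + n\<^sub>4 * r"
      "n dvd n\<^sub>2 * r + n\<^sub>4 * r \<Longrightarrow> n dvd n\<^sub>1 * r + n\<^sub>3 * r"
      "n dvd n\<^sub>3 * r + n\<^sub>4 * r \<Longrightarrow> n dvd n\<^sub>1 * r + n\<^sub>2 * r"
      and triples: "n dvd n\<^sub>1 * r + n\<^sub>2 * r + n\<^sub>3 * r \<Longrightarrow> n dvd n\<^sub>4 * r"
      "n dvd n\<^sub>1 * r + n\<^sub>2 * r + n\<^sub>4 * r \<Longrightarrow> n dvd n\<^sub>3 * r"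
      "n dvd n\<^sub>1 * r + n\<^sub>3 * r + n\<^sub>4 * r \<Longrightarrow> n dvd n\<^sub>2 * r"
      "n dvd n\<^sub>2 * r + n\<^sub>3 * r + n\<^sub>4 * r \<Longrightarrow> n dvd n\<^sub>1 * r"
      by (erule compl, simp)+
    have "n dvd n\<^sub>1 * r \<or> n dvd n\<^sub>2 * r \<or> n dvd n\<^sub>3 * r \<or> n dvd n\<^sub>4 * r \<or>
      n dvd n\<^sub>1 * r + n\<^sub>2 * r \<or> n dvd n\<^sub>1 * r + n\<^sub>3 * r \<or> n dvd n\<^sub>1 * r + n\<^sub>4 * r"
      using proper_subset_four[OF L(1,2)] L(3) pairs triples
      unfolding insert_iff empty_iff by metis
    then have "n dvd r * n\<^sub>1 \<or> n dvd r * n\<^sub>2 \<or> n dvd r * n\<^sub>3 \<or> n dvd r * n\<^sub>4 \<or>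
      n dvd r * (n\<^sub>1 + n\<^sub>2) \<or> n dvd r * (n\<^sub>1 + n\<^sub>3) \<or> n dvd r * (n\<^sub>1 + n\<^sub>4)"
      by (simp only: distrib_left mult.commute[of r])
    then show ?thesis unfolding r of_nat_add[symmetric] of_nat_mult[symmetric] int_dvd_int_iff .
  qed
  have "n \<noteq> 1" using nz by auto
  moreover have "n > 0" using fin assms(4) order_gt_0_iff_finite by blast
  ultimately have n1: "int n > 1" by simp
  have cop6: "coprime (int n) 6"
    using assms(5) by (metis coprime_iff_gcd_eq_1 coprime_int_iff of_nat_numeral)
  have sum4: "int n dvd int n\<^sub>1 + int n\<^sub>2 + int n\<^sub>3 + int n\<^sub>4"
    unfolding of_nat_add[symmetric] int_dvd_int_iff by (rule min(1))
  have "\<exists>m. coprime m (int n) \<and>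
    (m * int n\<^sub>1) mod int n + (m * int n\<^sub>2) mod int n + (m * int n\<^sub>3) mod int n + (m * int n\<^sub>4) mod int n = int n"
  proof (rule exists_unit_residue_sum[OF n1 cop6 sum4 _ _ _ _ _ _ _ _ red])
    show "coprime (int n\<^sub>1) (int n) \<or> coprime (int n\<^sub>2) (int n) \<or> coprime (int n\<^sub>3) (int n) \<or> coprime (int n\<^sub>4) (int n)"
      using assms(15) by (simp add: coprime_int_iff)
  qed (use nz nz2 in \<open>simp_all add: int_dvd_int_iff flip: of_nat_add\<close>)
  then obtain m where m: "coprime m (int n)"
    "(m * int n\<^sub>1) mod int n + (m * int n\<^sub>2) mod int n + (m * int n\<^sub>3) mod int n + (m * int n\<^sub>4) mod int n = int n"
    by blast
  \<comment> \<open>The generator sought is the power of \<open>g\<close> whose exponent inverts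
    \<open>m\<close>; passing to it multiplies coefficients by \<open>m\<close>.\<close>
  obtain i where i: "[m * i = 1] (mod int n)" using m(1) cong_solve_coprime_int by blast
  define j where "j = nat (i mod int n)"
  have j: "int j = i mod int n" using n1 by (simp add: j_def)
  have mj: "[m * int j = 1] (mod int n)" using i by (simp add: j cong_def mod_simps)
  then have "coprime (int j) (int n)" by (metis coprime_iff_invertible_int mult.commute)
  then have cj: "coprime j n" by (simp add: coprime_int_iff)
  then have "j \<noteq> 0" using n1 by (cases "j = 0") auto
  define h where "h = g [^] j"
  have hG: "h \<in> carrier G" using g by (simp add: h_def)
  have "ord h = n" using cj \<open>j \<noteq> 0\<close> ord_pow_gen[OF g, of j]
    by (simp add: h_def ordg coprime_iff_gcd_eq_1 gcd.commute)
  then have hgen: "h \<in> generators G" using generatorI[OF fin hG] assms(4) by simp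
  \<comment> \<open>As \<open>n\<close> does not divide \<open>k\<close>, the residue is nonzero and
    so lies in the range \<open>[1, n]\<close> of coefficients.\<close>
  have coeff: "int (seq_coeff G h (g [^] k)) = (m * int k) mod int n" if k: "\<not> n dvd k" for k
  proof -
    define l where "l = nat ((m * int k) mod int n)"
    have l: "int l = (m * int k) mod int n" using n1 by (simp add: l_def)
    have "\<not> int n dvd m * int k"
      using k m(1) by (simp add: coprime_dvd_mult_right_iff coprime_commute int_dvd_int_iff)
    then have "0 < int l" "int l < int n" using n1 by (simp_all add: l mod_pos_int)
    then have "l \<in> {1..order G}" using assms(4) by simp
    have "[int j * int l = int j * (m * int k)] (mod int n)"
      unfolding l by (intro cong_mult) (auto simp: cong_def)
    also have "int j * (m * int k) = (m * int j) * int k" by simp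
    also have "[\<dots> = 1 * int k] (mod int n)" using mj by (intro cong_mult) auto
    finally have "int n dvd int k - int (j * l)" by (simp add: cong_iff_dvd_diff dvd_diff_commute)
    then have "g [^] int (j * l) = g [^] int k" using int_pow_eq[OF g] ordg by blast
    then have "h [^] l = g [^] k" using g by (simp only: int_pow_int h_def nat_pow_pow)
    then show ?thesis using seq_coeff_pow[OF fin hgen \<open>l \<in> {1..order G}\<close>] l by simp
  qed
  have "int (\<Sum>x\<in>#S. seq_coeff G h x) = int n"
    unfolding assms(12) using coeff nz m(2) by (simp add: add.assoc)
  then have "(\<Sum>x\<in>#S. seq_coeff G h x) = n" by (simp only: of_nat_eq_iff)
  then have norm: "seq_norm G h S = 1" using \<open>n > 0\<close> assms(4) by (simp add: seq_norm_def)
  show ?thesis unfolding seq_index_def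
  proof (rule Min_eqI)
    show "finite ((\<lambda>h. seq_norm G h S) ` generators G)"
      using fin by (auto simp: generators_def)
    show "1 \<in> (\<lambda>h. seq_norm G h S) ` generators G" using hgen norm by force
    fix y assume "y \<in> (\<lambda>h. seq_norm G h S) ` generators G"
    moreover have "zero_sum G S" "S \<noteq> {#}" using assms(12,13) by (auto simp: minimal_zero_sum_def)
    ultimately show "1 \<le> y" using seq_norm_ge_1[OF fin] by blast
  qed
qed

end
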